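(* Let $\Phi:T\times\mathbb{R}^n\rightrightarrows\mathbb{R}^m$ be a set-valued normal integrand, let $\bar x\in\mathbb{R}^n$ and $\bar y\in \mathrm{E}_\Phi(\bar x)$, and suppose that there exist $\rho>0$ and $\kappa\in L^1(T,\mathbb{R})$ such that $\Phi_t(x)$ is convex for all $x\in\mathbb{B}_\rho(\bar x)$ and all $t\in T_{na}$, and $\Phi_t(x)\subseteq\kappa(t)\mathbb{B}$ for all $x\in\mathbb{B}_\rho(\bar x)$ and all $t\in T$. Assume that (a) either $\Phi$ is integrably quasi-Lipschitzian around $(\bar x,\bar{\mathsf y})$ for all $\bar{\mathsf y}\in\mathcal{S}_\Phi(\bar x,\bar y)$, and $\mathcal{S}_\Phi$ is inner semicompact at $(\bar x,\bar y)$; (b) or $\Phi$ is integrably locally Lipschitzian at $\bar x$. Then the expected-integral multifunction $\mathrm{E}_\Phi$ is Lipschitz-like around $(\bar x,\bar y)$.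
   Context: $(T,\mathcal{A},\mu)$ is a complete finite measure space and $T_{na}$ denotes the nonatomic part of $\mu$. $\mathbb{B}$ is the closed unit ball and $\mathbb{B}_r(x)$ the closed ball of radius $r$ centered at $x$. $L^p(T,\mathbb{R}^d)$ are the usual Lebesgue spaces; points of $\mathbb{R}^d$ are identified with constant functions. Set-valued normal integrand: $\Phi:T\times\mathbb{R}^n\rightrightarrows\mathbb{R}^m$ such that each $\Phi_t:=\Phi(t,\cdot)$ has closed graph and $\operatorname{gph}\Phi\in\mathcal{A}\otimes\mathcal{B}(\mathbb{R}^n\times\mathbb{R}^m)$ (equivalently, $t\mapsto\operatorname{gph}\Phi_t$ is a measurable multifunction with closed values). The expected-integral multifunction is $\mathrm{E}_\Phi(x):=\int_T\Phi_t(x)\,\mu(dt)$, where the integral of a multifunction is the Aumann integral, i.e. the set of all integrals of integrable a.e. selections. Moreover $\mathcal{S}_\Phi(x,y):=\{\mathsf{y}\in L^1(T,\mathbb{R}^m): \int_T\mathsf{y}(t)\mu(dt)=y,\ \mathsf{y}(t)\in\Phi_t(x)\text{ a.e.}\}$. Normal cones: for $C\subseteq\mathbb{R}^d$ and $x\in C$, $\hat N(x;C):=\{x^*:\limsup_{u\to x,\,u\in C}\langle x^*,u-x\rangle/\|u-x\|\le0\}$ (empty if $x\notin C$), and $N(x;C)$ is the set of all limits of sequences $x_k^*\in\hat N(x_k;C)$ with $x_k\to x$. Coderivative: for $M:\mathbb{R}^a\rightrightarrows\mathbb{R}^b$ and $(x,y)\in\operatorname{gph}M$, $D^*M(x,y)(y^*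 ):=\{x^*:(x^*,-y^* )\in N((x,y);\operatorname{gph}M)\}$. $\Phi$ is integrably quasi-Lipschitzian around $(\bar x,\bar{\mathsf y})$ if there exist $\eta>0$ and $\ell\in L^1(T,\mathbb{R}_+)$ such that for all $\mathsf{x}\in L^\infty(T,\mathbb{R}^n)$ with $\|\mathsf{x}-\bar x\|_\infty\le\eta$, all $\mathsf{y}\in L^1(T,\mathbb{R}^m)$ with $\|\mathsf{y}-\bar{\mathsf y}\|_1\le\eta$ and $\mathsf{y}(t)\in\Phi_t(\mathsf{x}(t))$ a.e., and all $\mathsf{y}^*\in L^\infty(T,\mathbb{R}^m)$, one has for a.e. $t\in T$: $\|x^*\|\le\ell(t)\|\mathsf{y}^*(t)\|$ whenever $x^*\in D^*\Phi_t(\mathsf{x}(t),\mathsf{y}(t))(\mathsf{y}^*(t))$. $\Phi$ is integrably locally Lipschitzian at $\bar x$ if there exist $\eta>0$, $\ell\in L^1(T,\mathbb{R})$ and $\hat T\in\mathcal{A}$ with $\mu(T\setminus\hat T)=0$ such that $\Phi_t(x)\subseteq\Phi_t(x')+\ell(t)\|x-x'\|\mathbb{B}$ for all $t\in\hat T$ and $x,x'\in\mathbb{B}_\eta(\bar x)$. $\mathcal{S}_\Phi$ is inner semicompact at $(\bar x,\bar y)$ if for every sequence $(x_k,y_k)\to(\bar x,\bar y)$ with $\mathcal{S}_\Phi(x_k,y_k)\neq\emptyset$ there is a sequence $\mathsf{y}_k\in\mathcal{S}_\Phi(x_k,y_k)$ containing an $L^1(T,\mathbb{R}^m)$-norm convergent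 subsequence. $F:\mathbb{R}^a\rightrightarrows\mathbb{R}^b$ is Lipschitz-like around $(x,y)\in\operatorname{gph}F$ if there exist $\ell\ge0$ and neighborhoods $U$ of $x$, $V$ of $y$ with $F(u)\cap V\subseteq F(v)+\ell\|u-v\|\mathbb{B}$ for all $u,v\in U$. *)

theory Defs
  imports "HOL-Analysis.Analysis"
begin

definition is_atom :: "'t measure \<Rightarrow> 't set \<Rightarrow> bool" where
  "is_atom M A \<longleftrightarrow> A \<in> sets M \<and> emeasure M A > 0 \<and>
     (\<forall>B\<in>sets M. B \<subseteq> A \<longrightarrow> emeasure M B = 0 \<or> emeasure M (A - B) = 0)"

text \<open>
  The splitting of a finite measure space into a nonatomic part and a countable disjoint union of
  atoms is unique only up to null sets, so the nonatomic part is specified by a predicate.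
\<close>

definition is_nonatomic_part :: "'t measure \<Rightarrow> 't set \<Rightarrow> bool" where
  "is_nonatomic_part M Tna \<longleftrightarrow> Tna \<in> sets M \<and> (\<forall>A. is_atom M A \<longrightarrow> \<not> A \<subseteq> Tna) \<and>
     (\<exists>\<A>. countable \<A> \<and> disjoint \<A> \<and> (\<forall>A\<in>\<A>. is_atom M A) \<and> space M - Tna = \<Union>\<A>)"

text \<open>
  Elements of Lebesgue spaces are represented by functions rather than by classes modulo null sets;
  every notion below depends on them only up to null sets.
  Membership in the space of integrable functions is \<^const>\<open>integrable\<close>.
\<close>

definition norm_L1 :: "'t measure \<Rightarrow> ('t \<Rightarrow> 'a::euclidean_space) \<Rightarrow> real" where
  "norm_L1 M f = (\<integral>t. norm (f t) \<partial>M)"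

definition Linfty :: "'t measure \<Rightarrow> ('t \<Rightarrow> 'a::euclidean_space) set" where
  "Linfty M = {f \<in> borel_measurable M. \<exists>K. AE t in M. norm (f t) \<le> K}"

definition graph_of :: "('a \<Rightarrow> 'b set) \<Rightarrow> ('a \<times> 'b) set" where
  "graph_of F = {(x, y). y \<in> F x}"

text \<open>
  At an isolated point of \<open>C\<close> the filter is trivial and the upper limit is minus infinity, so the
  cone is then the whole space.
\<close>

definition frechet_normal_cone :: "'a::real_inner \<Rightarrow> 'a set \<Rightarrow> 'a set" where
  "frechet_normal_cone x C = (if x \<in> C
     then {xs. Limsup (at x within C) (\<lambda>u. ereal (inner xs (u - x) / norm (u - x))) \<le> 0}
     else {})"

definition normal_cone :: "'a::real_inner \<Rightarrow> 'a set \<Rightarrow> 'a set" where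
  "normal_cone x C = {xs. \<exists>X Xs. X \<longlonglongrightarrow> x \<and> Xs \<longlonglongrightarrow> xs \<and>
     (\<forall>k. Xs k \<in> frechet_normal_cone (X k) C)}"

definition coderivative ::
  "('a::real_inner \<Rightarrow> 'b::real_inner set) \<Rightarrow> 'a \<Rightarrow> 'b \<Rightarrow> 'b \<Rightarrow> 'a set" where
  "coderivative F x y ys = {xs. (xs, - ys) \<in> normal_cone (x, y) (graph_of F)}"

definition normal_integrand ::
  "'t measure \<Rightarrow> ('t \<Rightarrow> 'a::euclidean_space \<Rightarrow> 'b::euclidean_space set) \<Rightarrow> bool" where
  "normal_integrand M \<Phi> \<longleftrightarrow>
     (\<forall>t\<in>space M. closed (graph_of (\<Phi> t))) \<and>
     {(t, x, y). t \<in> space M \<and> y \<in> \<Phi> t x} \<in> sets (M \<Otimes>\<^sub>M borel)"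

definition aumann_integral :: "'t measure \<Rightarrow> ('t \<Rightarrow> 'b::euclidean_space set) \<Rightarrow> 'b set" where
  "aumann_integral M F = {(\<integral>t. f t \<partial>M) | f. integrable M f \<and> (AE t in M. f t \<in> F t)}"

definition expected_integral ::
  "'t measure \<Rightarrow> ('t \<Rightarrow> 'a \<Rightarrow> 'b::euclidean_space set) \<Rightarrow> 'a \<Rightarrow> 'b set" where
  "expected_integral M \<Phi> x = aumann_integral M (\<lambda>t. \<Phi> t x)"

definition selections ::
  "'t measure \<Rightarrow> ('t \<Rightarrow> 'a \<Rightarrow> 'b::euclidean_space set) \<Rightarrow> 'a \<Rightarrow> 'b \<Rightarrow> ('t \<Rightarrow> 'b) set" where
  "selections M \<Phi> x y =
     {f. integrable M f \<and> (\<integral>t. f t \<partial>M) = y \<and> (AE t in M. f t \<in> \<Phi> t x)}"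

definition integrably_quasi_lipschitzian ::
  "'t measure \<Rightarrow> ('t \<Rightarrow> 'a::euclidean_space \<Rightarrow> 'b::euclidean_space set) \<Rightarrow> 'a \<Rightarrow> ('t \<Rightarrow> 'b) \<Rightarrow> bool"
  where
  "integrably_quasi_lipschitzian M \<Phi> xbar ybar \<longleftrightarrow>
     (\<exists>\<eta>>0. \<exists>\<l>. integrable M \<l> \<and> (\<forall>t\<in>space M. (0::real) \<le> \<l> t) \<and>
       (\<forall>x\<in>Linfty M. \<forall>y. \<forall>ys\<in>Linfty M.
          (AE t in M. norm (x t - xbar) \<le> \<eta>) \<longrightarrow>
          integrable M y \<longrightarrow> norm_L1 M (\<lambda>t. y t - ybar t) \<le> \<eta> \<longrightarrow>
          (AE t in M. y t \<in> \<Phi> t (x t)) \<longrightarrow>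
          (AE t in M. \<forall>xs\<in>coderivative (\<Phi> t) (x t) (y t) (ys t).
             norm xs \<le> \<l> t * norm (ys t))))"

definition integrably_locally_lipschitzian ::
  "'t measure \<Rightarrow> ('t \<Rightarrow> 'a::euclidean_space \<Rightarrow> 'b::euclidean_space set) \<Rightarrow> 'a \<Rightarrow> bool" where
  "integrably_locally_lipschitzian M \<Phi> xbar \<longleftrightarrow>
     (\<exists>\<eta>>0. \<exists>\<l>. \<exists>That\<in>sets M. integrable M \<l> \<and> emeasure M (space M - That) = 0 \<and>
       (\<forall>t\<in>That. \<forall>x\<in>cball xbar \<eta>. \<forall>x'\<in>cball xbar \<eta>.
          \<Phi> t x \<subseteq> \<Phi> t x' + (\<lambda>b. (\<l> t * norm (x - x')) *\<^sub>R b) ` cball 0 1))"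

definition inner_semicompact ::
  "'t measure \<Rightarrow> ('a::topological_space \<Rightarrow> ('t \<Rightarrow> 'b::euclidean_space) set) \<Rightarrow> 'a \<Rightarrow> bool" where
  "inner_semicompact M S z \<longleftrightarrow>
     (\<forall>Z. Z \<longlonglongrightarrow> z \<and> (\<forall>k. S (Z k) \<noteq> {}) \<longrightarrow>
       (\<exists>Y. (\<forall>k. Y k \<in> S (Z k)) \<and>
         (\<exists>r f. strict_mono r \<and> integrable M f \<and>
           (\<lambda>k. norm_L1 M (\<lambda>t. Y (r k) t - f t)) \<longlonglongrightarrow> 0)))"

definition lipschitz_like ::
  "('a::euclidean_space \<Rightarrow> 'b::euclidean_space set) \<Rightarrow> 'a \<Rightarrow> 'b \<Rightarrow> bool" where
  "lipschitz_like F x y \<longleftrightarrow> (x, y) \<in> graph_of F \<and>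
     (\<exists>\<l>\<ge>0. \<exists>U V. open U \<and> x \<in> U \<and> open V \<and> y \<in> V \<and>
       (\<forall>u\<in>U. \<forall>v\<in>U. F u \<inter> V \<subseteq> F v + (\<lambda>b. (\<l> * norm (u - v)) *\<^sub>R b) ` cball 0 1))"

end

theory Submission
  imports Defs
begin

text \<open>
  Consider a point \<open>y\<close> of the expected integral at \<open>u\<close>, say \<open>y = \<integral>Y\<close> with \<open>Y t \<in> \<Phi> t u\<close>, and a nearby
  point \<open>v\<close>. It suffices to transport \<open>Y\<close> measurably to a selection \<open>z\<close> at \<open>v\<close> such that
  \<open>norm (z t - Y t) \<le> k t * norm (u - v)\<close> with an integrable \<open>k\<close>; then \<open>\<integral>z\<close> lies within
  \<open>(\<integral>k) * norm (u - v)\<close> of \<open>y\<close>. In both cases \<open>z t\<close> is found by minimizing a distance.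
  
  Under the local Lipschitz condition, \<open>z t\<close> is the point of \<open>\<Phi> t v\<close> nearest to \<open>Y t\<close>.
  
  Under the quasi-Lipschitz condition, minimize over the graph of \<open>\<Phi> t\<close> a smoothed weighted distance to
  \<open>(v, Y t)\<close>, with weight \<open>l t + 1\<close> on the first component. At a minimizer \<open>(x t, z t)\<close> with
  \<open>x t \<noteq> v\<close>, Fermat's rule exhibits a coderivative element of norm \<open>l t + 1\<close> over an argument of norm at
  most \<open>1\<close>, which contradicts the modulus \<open>l\<close> (lemma \<open>steep_coderivative_at_penalty_minimizer\<close>). Hence
  \<open>x t = v\<close> almost everywhere, and \<open>z\<close> is the required selection (lemma
  \<open>quasi_lipschitzian_selection\<close>). As the modulus belongs to a particular selection over
  \<open>(xbar, ybar)\<close>, inner semicompactness is used to pass from a sequence of supposed violations to one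
  such selection.
  
  The minimizers must be chosen measurably although the graph of \<open>\<Phi>\<close> is only known to be measurable in
  the product space. This rests on the measurable projection theorem for complete finite measures
  (theorem \<open>measurable_projection\<close>): measurable subsets of the product are analytic, and projections of
  analytic sets are approximated from inside in measure by Choquet's capacitability argument. Minimizers
  are then selected by minimizing the coordinates one after another (lemma
  \<open>measurable_argmin_selection\<close>).
\<close>

section \<open>Measurability of projections\<close>

text \<open>
  Both the set and a measurable superset of the same outer measure are exhausted from inside, so the
  two differ by a null set, and completeness applies.
\<close>

lemma inner_approximable_imp_measurable:
  fixes P :: "'t set"
  assumes "complete_measure M" "finite_measure M" and P: "P \<subseteq> space M"
    and inner: "\<And>c. c < outer_measure_of M P \<Longrightarrow> \<exists>B\<in>sets M. B \<subseteq> P \<and> c \<le> emeasure M B"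
  shows "P \<in> sets M"
proof -
  interpret complete_measure M by fact
  interpret finite_measure M by fact
  obtain E where E: "E \<in> sets M" "P \<subseteq> E" "outer_measure_of M P = emeasure M E"
    using outer_measure_of_attain[OF P] by blast
  let ?I = "SUP B\<in>{B\<in>sets M. B \<subseteq> P}. emeasure M B"
  have ne: "{B\<in>sets M. B \<subseteq> P} \<noteq> {}" by blast
  obtain F :: "nat \<Rightarrow> ennreal" where F: "range F \<subseteq> emeasure M ` {B\<in>sets M. B \<subseteq> P}" "?I = (SUP i. F i)"
    using ennreal_SUP_countable_SUP[OF ne, of "emeasure M"] by auto
  have "\<forall>i. \<exists>B. B \<in> sets M \<and> B \<subseteq> P \<and> F i = emeasure M B"
    using F(1) by blast
  then obtain B where B: "\<And>i. B i \<in> sets M" "\<And>i. B i \<subseteq> P" "\<And>i. F i = emeasure M (B i)"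
    by metis
  let ?B = "\<Union>i. B i"
  have Bm: "?B \<in> sets M" "?B \<subseteq> P" using B by auto
  have "emeasure M E \<le> ?I"
  proof (rule dense_le)
    fix c assume "c < emeasure M E"
    then obtain C where "C \<in> sets M" "C \<subseteq> P" "c \<le> emeasure M C"
      using inner E(3) by metis
    then show "c \<le> ?I" by (intro SUP_upper2[of C]) auto
  qed
  also have "\<dots> \<le> emeasure M ?B"
    unfolding F(2) B(3) by (intro SUP_least emeasure_mono Bm) auto
  finally have "emeasure M E = emeasure M ?B"
    using Bm E emeasure_mono[of ?B E M] by (intro antisym) auto
  then have "emeasure M (E - ?B) = 0"
    using emeasure_Diff[of M ?B E] Bm E by (simp add: subset_trans[OF Bm(2) E(2)])
  then have "P - ?B \<in> sets M"
    using E Bm by (intro complete[of "P - ?B" "E - ?B"]) auto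
  then have "(P - ?B) \<union> ?B \<in> sets M" using Bm by blast
  also have "(P - ?B) \<union> ?B = P" using Bm by blast
  finally show ?thesis .
qed

lemma compact_Inter_decseq_nonempty:
  fixes F :: "nat \<Rightarrow> 'a::t2_space set"
  assumes "compact (F 0)" "\<And>n. closed (F n)" "\<And>n. F n \<noteq> {}" "decseq F"
  shows "(\<Inter>n. F n) \<noteq> {}"
proof -
  have "F 0 \<inter> (\<Inter>n\<in>UNIV. F n) \<noteq> {}"
  proof (rule compact_imp_fip_image)
    fix I :: "nat set" assume I: "finite I"
    obtain k where "\<forall>i\<in>I. i \<le> k" using I by (meson finite_nat_set_iff_bounded_le)
    then have "F k \<subseteq> F 0 \<inter> (\<Inter>n\<in>I. F n)"
      using decseqD[OF assms(4)] by blast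
    then show "F 0 \<inter> (\<Inter>n\<in>I. F n) \<noteq> {}" using assms(3)[of k] by blast
  qed (use assms in auto)
  then show ?thesis by blast
qed

text \<open>
  This is Choquet's capacitability argument. Since the outer measure is continuous along increasing
  sequences of arbitrary sets, each countable union over \<open>j\<close> can be cut down to a finite one while
  the outer measure of the projection stays above a prescribed level \<open>c\<close>. The projection of a finite
  intersection of such finite unions of rectangles is measurable, and by compactness in the second
  factor the projection commutes with the decreasing intersection that remains. This produces a
  measurable subset of the projection whose measure is at least \<open>c\<close>.
\<close>

lemma measurable_projection_sigma_delta:
  fixes A :: "nat \<Rightarrow> nat \<Rightarrow> 't set" and K :: "nat \<Rightarrow> nat \<Rightarrow> 'z::t2_space set"
  assumes cpl: "complete_measure M" and fin: "finite_measure M"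
    and A: "\<And>n j. A n j \<in> sets M"
    and K: "\<And>n j. closed (K n j)" "\<And>j. compact (K 0 j)"
  shows "{t. \<exists>z. \<forall>n. \<exists>j. t \<in> A n j \<and> z \<in> K n j} \<in> sets M"
proof -
  interpret finite_measure M by fact
  define pr where "pr X = {t\<in>space M. \<exists>z. (t, z) \<in> X}" for X :: "('t \<times> 'z) set"
  define W where "W n m = {(t, z). \<exists>j\<le>m. t \<in> A n j \<and> z \<in> K n j}" for n m :: nat
  define H where "H = {(t, z). \<forall>n. \<exists>j. t \<in> A n j \<and> z \<in> K n j}"
  have pr_mono: "pr X \<subseteq> pr Y" if "X \<subseteq> Y" for X Y using that by (auto simp: pr_def)
  have "pr H \<in> sets M"
  proof (rule inner_approximable_imp_measurable[OF cpl fin])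
    show "pr H \<subseteq> space M" by (auto simp: pr_def)
  next
    fix c assume c: "c < outer_measure_of M (pr H)"
    have "\<exists>X. \<forall>n. (X n \<subseteq> H \<and> c < outer_measure_of M (pr (X n))) \<and>
                (\<exists>m. X (Suc n) = X n \<inter> W n m)"
    proof (rule dependent_nat_choice)
      show "\<exists>X. X \<subseteq> H \<and> c < outer_measure_of M (pr X)" using c by blast
    next
      fix X n assume X: "X \<subseteq> H \<and> c < outer_measure_of M (pr X)"
      have "X = (\<Union>m. X \<inter> W n m)"
      proof (intro equalityI subsetI)
        fix p assume "p \<in> X"
        moreover obtain t z where p: "p = (t, z)" by (cases p)
        ultimately have "(t, z) \<in> H" using X by blast
        then obtain j where "t \<in> A n j \<and> z \<in> K n j" by (auto simp: H_def)
        then have "p \<in> W n j" using p by (auto simp: W_def)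
        then show "p \<in> (\<Union>m. X \<inter> W n m)" using \<open>p \<in> X\<close> by blast
      qed auto
      then have "pr X = (\<Union>m. pr (X \<inter> W n m))" unfolding pr_def by blast
      moreover have "incseq (\<lambda>m. pr (X \<inter> W n m))"
        by (intro monoI pr_mono) (auto simp: W_def intro: order_trans)
      ultimately have "(SUP m. outer_measure_of M (pr (X \<inter> W n m))) = outer_measure_of M (pr X)"
        using SUP_outer_measure_of_incseq[of "\<lambda>m. pr (X \<inter> W n m)" M] by (auto simp: pr_def)
      then have "c < (SUP m. outer_measure_of M (pr (X \<inter> W n m)))" using X by simp
      then obtain m where "c < outer_measure_of M (pr (X \<inter> W n m))"
        by (auto simp: less_SUP_iff)
      then show "\<exists>Y. (Y \<subseteq> H \<and> c < outer_measure_of M (pr Y)) \<and> (\<exists>m. Y = X \<inter> W n m)"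
        using X by blast
    qed
    then obtain X where X: "\<And>n. X n \<subseteq> H" "\<And>n. c < outer_measure_of M (pr (X n))"
        "\<And>n. \<exists>m. X (Suc n) = X n \<inter> W n m" by blast
    then obtain m where m: "\<And>n. X (Suc n) = X n \<inter> W n (m n)" by metis
    define L where "L n = {(t, z). \<forall>i<n. (t, z) \<in> W i (m i)}" for n
    have XL: "X n \<subseteq> L n" for n
    proof (induction n)
      case (Suc n) then show ?case using m[of n] by (auto simp: L_def less_Suc_eq)
    qed (auto simp: L_def)
    \<comment> \<open>The closed set \<open>C\<close> accumulates the second factors of the rectangles already intersected.\<close>
    have meas: "pr (L n \<inter> UNIV \<times> C) \<in> sets M" if "closed C" for n C
      using that
    proof (induction n arbitrary: C)
      case 0
      have "pr (L 0 \<inter> UNIV \<times> C) = (if C = {} then {} else space M)"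
        by (auto simp: pr_def L_def)
      then show ?case by simp
    next
      case (Suc n)
      have "pr (L (Suc n) \<inter> UNIV \<times> C) =
          (\<Union>j\<le>m n. A n j \<inter> pr (L n \<inter> UNIV \<times> (K n j \<inter> C)))"
      proof (intro equalityI subsetI)
        fix t assume "t \<in> pr (L (Suc n) \<inter> UNIV \<times> C)"
        then obtain z where z: "t \<in> space M" "(t, z) \<in> L (Suc n)" "z \<in> C"
          by (auto simp: pr_def)
        have "(t, z) \<in> L n" using z(2) by (auto simp: L_def)
        moreover obtain j where "j \<le> m n" "t \<in> A n j" "z \<in> K n j"
          using z(2) by (auto simp: L_def W_def)
        ultimately show "t \<in> (\<Union>j\<le>m n. A n j \<inter> pr (L n \<inter> UNIV \<times> (K n j \<inter> C)))"
          using z unfolding pr_def by blast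
      qed (auto simp: pr_def L_def W_def less_Suc_eq)
      also have "\<dots> \<in> sets M"
        by (intro sets.finite_UN sets.Int A Suc.IH closed_Int K Suc.prems) auto
      finally show ?case .
    qed
    have Lm: "pr (L n) \<in> sets M" for n using meas[of UNIV n] by simp
    have Ldec: "decseq (\<lambda>n. pr (L n))"
      by (intro antimonoI pr_mono) (auto simp: L_def)
    let ?B = "\<Inter>n. pr (L n)"
    have "?B \<in> sets M" using Lm by blast
    moreover have "?B \<subseteq> pr H"
    proof
      fix t assume t: "t \<in> ?B"
      define S where "S n = {z. (t, z) \<in> L (Suc n)}" for n
      have sec: "{z. (t, z) \<in> W i k} = (\<Union>j\<in>{j. j \<le> k \<and> t \<in> A i j}. K i j)" for i k
        by (auto simp: W_def)
      have S: "S n = (\<Inter>i\<in>{..n}. {z. (t, z) \<in> W i (m i)})" for n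
        by (auto simp: S_def L_def less_Suc_eq_le)
      have "(\<Inter>n. S n) \<noteq> {}"
      proof (rule compact_Inter_decseq_nonempty)
        show "compact (S 0)" unfolding S sec using K(2) by (auto intro!: compact_UN)
        show "closed (S n)" for n unfolding S sec using K(1) by (auto intro!: closed_INT closed_UN)
        show "S n \<noteq> {}" for n using t by (auto simp: S_def pr_def)
        show "decseq S" by (intro antimonoI) (auto simp: S)
      qed
      then obtain z where "z \<in> S n" for n by blast
      then have "(t, z) \<in> W n (m n)" for n by (auto simp: S)
      then have "(t, z) \<in> H" unfolding H_def W_def by blast
      then show "t \<in> pr H" using t by (auto simp: pr_def)
    qed
    moreover have "c \<le> emeasure M ?B"
    proof -
      have "c \<le> emeasure M (pr (L n))" for n
      proof -
        have "c < outer_measure_of M (pr (X n))" by (rule X)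
        also have "\<dots> \<le> outer_measure_of M (pr (L n))"
          by (intro outer_measure_of_mono pr_mono XL)
        finally show ?thesis using Lm by simp
      qed
      then have "c \<le> (INF n. emeasure M (pr (L n)))" by (rule INF_greatest)
      also have "\<dots> = emeasure M ?B"
        by (intro INF_emeasure_decseq Ldec) (use Lm in auto)
      finally show ?thesis .
    qed
    ultimately show "\<exists>B\<in>sets M. B \<subseteq> pr H \<and> c \<le> emeasure M B" by blast
  qed
  also have "pr H = {t. \<exists>z. \<forall>n. \<exists>j. t \<in> A n j \<and> z \<in> K n j}"
  proof -
    have "t \<in> space M" if "\<forall>n. \<exists>j. t \<in> A n j \<and> z \<in> K n j" for t z
      using that sets.sets_into_space[OF A] by blast
    then show ?thesis by (auto simp: pr_def H_def)
  qed
  finally show ?thesis .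
qed

text \<open>
  A countable product of compact intervals serves as the space of parameters of analytic sets: it is
  compact, it contains countably many copies of itself as factors, and the values of a single
  coordinate can label the members of a sequence.
\<close>

definition hilbert_cube :: "(nat \<Rightarrow> real) set" where
  "hilbert_cube = (\<Pi>\<^sub>E i\<in>UNIV. {0..1})"

lemma hilbert_cube_iff: "e \<in> hilbert_cube \<longleftrightarrow> (\<forall>i. 0 \<le> e i \<and> e i \<le> 1)"
  by (auto simp: hilbert_cube_def PiE_iff)

lemma compact_hilbert_cube: "compact hilbert_cube"
proof -
  have "compactin (product_topology (\<lambda>i::nat. euclideanreal) UNIV) hilbert_cube"
    unfolding hilbert_cube_def by (subst compactin_PiE) auto
  then show ?thesis
    by (simp add: euclidean_product_topology flip: compactin_euclidean_iff)
qed

text \<open>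
  Such a set is the projection along the cube of a countable intersection of countable unions of
  rectangles with measurable first and closed second factor. Allowing the additional parameter
  \<open>e\<close> is what makes the class stable under countable unions as well as countable intersections.
\<close>

definition analytic_over :: "'t measure \<Rightarrow> ('t \<times> 'b::euclidean_space) set \<Rightarrow> bool" where
  "analytic_over M G \<longleftrightarrow>
     (\<exists>A K. (\<forall>n j. A n j \<in> sets M) \<and> (\<forall>n j. closed (K n j)) \<and>
        G = {(t, y). \<exists>e\<in>hilbert_cube. \<forall>n::nat. \<exists>j::nat. t \<in> A n j \<and> (y, e) \<in> K n j})"

lemma analytic_overI:
  assumes "\<And>n j. A n j \<in> sets M" "\<And>n j. closed (K n j)"
    and "\<And>t y. (t, y) \<in> G \<longleftrightarrow>
           (\<exists>e\<in>hilbert_cube. \<forall>n::nat. \<exists>j::nat. t \<in> A n j \<and> (y, e) \<in> K n j)"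
  shows "analytic_over M G"
proof -
  have "G = {(t, y). \<exists>e\<in>hilbert_cube. \<forall>n::nat. \<exists>j::nat. t \<in> A n j \<and> (y, e) \<in> K n j}"
    using assms(3) by blast
  then show ?thesis unfolding analytic_over_def using assms(1,2) by blast
qed

lemma analytic_over_Times:
  assumes "A \<in> sets M" "closed C"
  shows "analytic_over M (A \<times> C)"
proof (rule analytic_overI)
  show "closed (C \<times> (UNIV :: (nat \<Rightarrow> real) set))" using assms by (intro closed_Times) auto
  have "(\<lambda>_. 0) \<in> hilbert_cube" by (simp add: hilbert_cube_iff)
  then show "(t, y) \<in> A \<times> C \<longleftrightarrow>
     (\<exists>e\<in>hilbert_cube. \<forall>n::nat. \<exists>j::nat. t \<in> A \<and> (y, e) \<in> C \<times> UNIV)" for t y by auto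
qed (fact assms)

lemma analytic_over_sequenceE:
  fixes G :: "nat \<Rightarrow> ('t \<times> 'b::euclidean_space) set"
  assumes "\<And>i. analytic_over M (G i)"
  obtains A K where "\<And>i n j. A i n j \<in> sets M" "\<And>i n j. closed (K i n j)"
    "\<And>i. G i = {(t, y). \<exists>e\<in>hilbert_cube. \<forall>n::nat. \<exists>j::nat. t \<in> A i n j \<and> (y, e) \<in> K i n j}"
proof -
  let ?P = "\<lambda>i A K. (\<forall>n j. A n j \<in> sets M) \<and> (\<forall>n j. closed (K n j)) \<and>
        G i = {(t, y). \<exists>e\<in>hilbert_cube. \<forall>n::nat. \<exists>j::nat. t \<in> A n j \<and> (y, e) \<in> K n j}"
  have "\<forall>i. \<exists>A K. ?P i A K"
    using assms unfolding analytic_over_def by blast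
  from choice[OF this] obtain A where "\<forall>i. \<exists>K. ?P i (A i) K" ..
  from choice[OF this] obtain K where P: "\<forall>i. ?P i (A i) (K i)" ..
  show thesis
  proof (rule that)
    show "A i n j \<in> sets M" "closed (K i n j)"
      "G i = {(t, y). \<exists>e\<in>hilbert_cube. \<forall>n::nat. \<exists>j::nat. t \<in> A i n j \<and> (y, e) \<in> K i n j}" for i n j
      using P by blast+
  qed
qed

text \<open>
  A single parameter \<open>e\<close> encodes a whole sequence of parameters: its coordinates are arranged as an
  infinite matrix through the pairing function, and row \<open>i\<close> is the parameter of the \<open>i\<close>-th set.
\<close>

lemma analytic_over_Inter:
  fixes G :: "nat \<Rightarrow> ('t \<times> 'b::euclidean_space) set"
  assumes "\<And>i. analytic_over M (G i)"
  shows "analytic_over M (\<Inter>i. G i)"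
proof -
  obtain A K where A: "\<And>i n j. A i n j \<in> sets M" and K: "\<And>i n j. closed (K i n j)"
    and G: "\<And>i. G i = {(t, y). \<exists>e\<in>hilbert_cube. \<forall>n::nat. \<exists>j::nat.
                t \<in> A i n j \<and> (y, e) \<in> K i n j}"
    using analytic_over_sequenceE[of M G, OF assms] by blast
  define row where "row i e = (\<lambda>k. e (prod_encode (i, k)))" for i and e :: "nat \<Rightarrow> real"
  define A' where "A' N = (case prod_decode N of (i, n) \<Rightarrow> A i n)" for N
  define K' where "K' N j = (case prod_decode N of (i, n) \<Rightarrow> (\<lambda>(y, e). (y, row i e)) -` K i n j)"
    for N j
  show ?thesis
  proof (rule analytic_overI)
    show "A' N j \<in> sets M" for N j by (auto simp: A'_def A split: prod.split)
    have "continuous_on UNIV (\<lambda>(y::'b, e). (y, row i e))" for i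
      unfolding case_prod_beta row_def
      by (intro continuous_on_Pair continuous_on_coordinatewise_then_product continuous_intros
          continuous_on_compose2[OF continuous_on_product_coordinates continuous_on_snd]) auto
    then show "closed (K' N j)" for N j
      by (auto simp: K'_def K split: prod.split intro!: closed_vimage)
  next
    fix t y
    show "(t, y) \<in> (\<Inter>i. G i) \<longleftrightarrow>
       (\<exists>e\<in>hilbert_cube. \<forall>N. \<exists>j. t \<in> A' N j \<and> (y, e) \<in> K' N j)" (is "_ \<longleftrightarrow> ?R")
    proof
      assume "(t, y) \<in> (\<Inter>i. G i)"
      then have "\<forall>i. \<exists>e. e \<in> hilbert_cube \<and> (\<forall>n. \<exists>j. t \<in> A i n j \<and> (y, e) \<in> K i n j)"
        by (fastforce simp: G)
      then obtain e where e: "\<And>i. e i \<in> hilbert_cube"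
          "\<And>i n. \<exists>j. t \<in> A i n j \<and> (y, e i) \<in> K i n j" by metis
      define e' where "e' N = (case prod_decode N of (i, k) \<Rightarrow> e i k)" for N
      have "row i e' = e i" for i by (auto simp: row_def e'_def)
      moreover have "e' \<in> hilbert_cube"
        using e(1) by (auto simp: hilbert_cube_iff e'_def split: prod.split)
      ultimately show ?R
        using e(2) by (intro bexI[of _ e']) (auto simp: A'_def K'_def split: prod.split)
    next
      assume ?R
      then obtain e where e: "e \<in> hilbert_cube" "\<And>N. \<exists>j. t \<in> A' N j \<and> (y, e) \<in> K' N j" by blast
      have "\<exists>j. t \<in> A i n j \<and> (y, row i e) \<in> K i n j" for i n
        using e(2)[of "prod_encode (i, n)"] by (auto simp: A'_def K'_def)
      moreover have "row i e \<in> hilbert_cube" for i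
        using e(1) by (auto simp: hilbert_cube_iff row_def)
      ultimately show "(t, y) \<in> (\<Inter>i. G i)" by (auto simp: G)
    qed
  qed
qed

text \<open>
  The coordinate \<open>e 0\<close> names the member of the union that is used, and the remaining coordinates are
  the parameter of that member. As the names are distinct, one index \<open>i\<close> works for all conditions
  \<open>n\<close> at once, which allows the union over \<open>i\<close> to be moved inside the intersection over \<open>n\<close>.
\<close>

lemma analytic_over_Union:
  fixes G :: "nat \<Rightarrow> ('t \<times> 'b::euclidean_space) set"
  assumes "\<And>i. analytic_over M (G i)"
  shows "analytic_over M (\<Union>i. G i)"
proof -
  obtain A K where A: "\<And>i n j. A i n j \<in> sets M" and K: "\<And>i n j. closed (K i n j)"
    and G: "\<And>i. G i = {(t, y). \<exists>e\<in>hilbert_cube. \<forall>n::nat. \<exists>j::nat.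
                t \<in> A i n j \<and> (y, e) \<in> K i n j}"
    using analytic_over_sequenceE[of M G, OF assms] by blast
  define mark where "mark i = 1 / (real i + 1)" for i :: nat
  have mark_inj: "mark i = mark j \<longleftrightarrow> i = j" for i j by (auto simp: mark_def field_simps)
  have mark01: "0 \<le> mark i" "mark i \<le> 1" for i by (auto simp: mark_def)
  define tail where "tail e = (\<lambda>k. e (Suc k))" for e :: "nat \<Rightarrow> real"
  define A' where "A' n N = (case prod_decode N of (i, j) \<Rightarrow> A i n j)" for n N
  define K' where "K' n N = (case prod_decode N of (i, j) \<Rightarrow>
      {(y, e). e 0 = mark i} \<inter> (\<lambda>(y, e). (y, tail e)) -` K i n j)" for n N
  show ?thesis
  proof (rule analytic_overI)
    show "A' n N \<in> sets M" for n N by (auto simp: A'_def A split: prod.split)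
    have "continuous_on UNIV (\<lambda>(y::'b, e). (y, tail e))"
      unfolding case_prod_beta tail_def
      by (intro continuous_on_Pair continuous_on_coordinatewise_then_product continuous_intros
          continuous_on_compose2[OF continuous_on_product_coordinates continuous_on_snd]) auto
    moreover have "closed {(y::'b, e::nat \<Rightarrow> real). e 0 = mark i}" for i
      unfolding case_prod_beta
      by (intro closed_Collect_eq continuous_intros
          continuous_on_compose2[OF continuous_on_product_coordinates continuous_on_snd]) auto
    ultimately show "closed (K' n N)" for n N
      by (auto simp: K'_def K split: prod.split intro!: closed_Int closed_vimage)
  next
    fix t y
    show "(t, y) \<in> (\<Union>i. G i) \<longleftrightarrow>
       (\<exists>e\<in>hilbert_cube. \<forall>n. \<exists>N. t \<in> A' n N \<and> (y, e) \<in> K' n N)" (is "_ \<longleftrightarrow> ?R")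
    proof
      assume "(t, y) \<in> (\<Union>i. G i)"
      then obtain i e where e: "e \<in> hilbert_cube" "\<And>n. \<exists>j. t \<in> A i n j \<and> (y, e) \<in> K i n j"
        by (auto simp: G)
      define e' where "e' = case_nat (mark i) e"
      have "e' 0 = mark i" "tail e' = e" by (auto simp: e'_def tail_def)
      moreover have "e' \<in> hilbert_cube"
        using e(1) mark01[of i] by (auto simp: hilbert_cube_iff e'_def split: nat.split)
      moreover have "\<exists>N. t \<in> A' n N \<and> (y, e') \<in> K' n N" for n
      proof -
        obtain j where "t \<in> A i n j \<and> (y, e) \<in> K i n j" using e(2) by blast
        then show ?thesis using calculation
          by (intro exI[of _ "prod_encode (i, j)"]) (auto simp: A'_def K'_def)
      qed
      ultimately show ?R by blast
    next
      assume ?R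
      then obtain e where e: "e \<in> hilbert_cube" "\<And>n. \<exists>N. t \<in> A' n N \<and> (y, e) \<in> K' n N" by blast
      have ij: "\<exists>i j. e 0 = mark i \<and> t \<in> A i n j \<and> (y, tail e) \<in> K i n j" for n
      proof -
        obtain N where N: "t \<in> A' n N \<and> (y, e) \<in> K' n N" using e(2) by blast
        obtain i j where "prod_decode N = (i, j)" by (cases "prod_decode N")
        then show ?thesis using N by (auto simp: A'_def K'_def)
      qed
      obtain i where i: "e 0 = mark i" using ij[of 0] by blast
      have "\<exists>j. t \<in> A i n j \<and> (y, tail e) \<in> K i n j" for n
        using ij[of n] i by (auto simp: mark_inj)
      moreover have "tail e \<in> hilbert_cube"
        using e(1) by (auto simp: hilbert_cube_iff tail_def)
      ultimately show "(t, y) \<in> (\<Union>i. G i)" by (auto simp: G)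
    qed
  qed
qed

lemma analytic_over_Un:
  assumes "analytic_over M G" "analytic_over M H"
  shows "analytic_over M (G \<union> H)"
proof -
  have "analytic_over M (\<Union>i. case_nat G (\<lambda>_. H) i)"
    by (intro analytic_over_Union) (use assms in \<open>auto split: nat.split\<close>)
  also have "(\<Union>i. case_nat G (\<lambda>_. H) i) = G \<union> H"
    by (auto split: nat.splits)
  finally show ?thesis .
qed

text \<open>
  The class is not stable under complements, so the induction over the Borel sets carries the
  complement along; open sets enter as countable unions of closed ones.
\<close>

lemma analytic_over_measurable_Times:
  fixes B :: "'b::euclidean_space set"
  assumes A: "A \<in> sets M" and B: "B \<in> sets borel"
  shows "analytic_over M (A \<times> B) \<and> analytic_over M (A \<times> (- B))"
proof -
  have "B \<in> sigma_sets UNIV (Collect closed)"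
    using B by (simp add: borel_eq_closed sets_measure_of)
  then show ?thesis
  proof induction
    case (Basic C)
    then have "open (- C)" by (simp add: open_Compl)
    then obtain K :: "nat \<Rightarrow> 'b set" where K: "\<And>i. closed (K i)" "- C = (\<Union>i. K i)"
      by (metis open_Union_compact_subsets compact_imp_closed)
    have "A \<times> (- C) = (\<Union>i. A \<times> K i)" using K(2) by auto
    then show ?case using Basic K(1) A
      by (auto intro!: analytic_over_Union analytic_over_Times)
  next
    case Empty
    show ?case using analytic_over_Times[OF A closed_empty] analytic_over_Times[OF A closed_UNIV]
      by simp
  next
    case (Compl a)
    then show ?case by (simp add: Compl_eq_Diff_UNIV double_diff)
  next
    case (Union a)
    have "A \<times> (\<Union>i. a i) = (\<Union>i. A \<times> a i)" "A \<times> (- (\<Union>i. a i)) = (\<Inter>i. A \<times> (- a i))" by auto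
    then show ?case using Union by (auto intro!: analytic_over_Union analytic_over_Inter)
  qed
qed

lemma analytic_over_measurable:
  fixes G :: "('t \<times> 'b::euclidean_space) set"
  assumes "G \<in> sets (M \<Otimes>\<^sub>M borel)"
  shows "analytic_over M G"
proof -
  have "G \<in> sigma_sets (space M \<times> UNIV) {A \<times> B | A B. A \<in> sets M \<and> B \<in> sets (borel :: 'b measure)}"
    using assms by (simp add: sets_pair_measure)
  then have "analytic_over M G \<and> analytic_over M (space M \<times> UNIV - G)"
  proof induction
    case (Basic R)
    then obtain A and B :: "'b set" where R: "R = A \<times> B" "A \<in> sets M" "B \<in> sets borel" by auto
    have "space M \<times> UNIV - R = (space M - A) \<times> UNIV \<union> A \<times> (- B)"
      using R sets.sets_into_space by auto
    moreover have "analytic_over M ((space M - A) \<times> (UNIV :: 'b set))"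
      using R(2) by (intro analytic_over_Times) auto
    ultimately show ?case
      using R analytic_over_measurable_Times[OF R(2,3)] by (simp add: analytic_over_Un)
  next
    case Empty
    show ?case using analytic_over_Times[OF sets.top closed_UNIV, of M]
        analytic_over_Times[OF sets.top closed_empty, of M] by simp
  next
    case (Compl a)
    have "a \<subseteq> space M \<times> UNIV"
      by (rule sigma_sets_into_sp[OF _ Compl.hyps]) (use sets.sets_into_space in blast)
    then have "space M \<times> UNIV - (space M \<times> UNIV - a) = a" by (rule double_diff) simp
    then show ?case using Compl by simp
  next
    case (Union a)
    have "space M \<times> UNIV - (\<Union>i. a i) = (\<Inter>i. space M \<times> UNIV - a i)" by auto
    moreover have "analytic_over M (\<Inter>i. space M \<times> UNIV - a i)" "analytic_over M (\<Union>i. a i)"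
      using Union.IH by (blast intro: analytic_over_Union analytic_over_Inter)+
    ultimately show ?case by simp
  qed
  then show ?thesis by blast
qed

text \<open>
  The measurable projection theorem: after the Euclidean factor has been exhausted by balls, the
  second factors become compact and the capacitability argument applies.
\<close>

theorem measurable_projection:
  fixes G :: "('t \<times> 'b::euclidean_space) set"
  assumes cpl: "complete_measure M" and fin: "finite_measure M" and G: "G \<in> sets (M \<Otimes>\<^sub>M borel)"
  shows "{t \<in> space M. \<exists>y. (t, y) \<in> G} \<in> sets M"
proof -
  obtain A K where A: "\<And>n j. A n j \<in> sets M" and K: "\<And>n j. closed (K n j)"
    and Geq: "G = {(t, y). \<exists>e\<in>hilbert_cube. \<forall>n::nat. \<exists>j::nat. t \<in> A n j \<and> (y, e) \<in> K n j}"
    using analytic_over_measurable[OF G] unfolding analytic_over_def by auto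
  \<comment> \<open>An extra first condition confines the second component to a compact set.\<close>
  define A' where "A' n = case_nat (\<lambda>_. space M) A n" for n
  define K' where "K' n = case_nat (\<lambda>j. cball 0 (real j) \<times> hilbert_cube) K n" for n
  have "{t. \<exists>z. \<forall>n. \<exists>j. t \<in> A' n j \<and> z \<in> K' n j} \<in> sets M"
  proof (rule measurable_projection_sigma_delta[OF cpl fin])
    show "A' n j \<in> sets M" for n j using A by (auto simp: A'_def split: nat.split)
    show cK: "compact (K' 0 j)" for j
      by (auto simp: K'_def intro!: compact_Times compact_hilbert_cube)
    show "closed (K' n j)" for n j
      using K cK[THEN compact_imp_closed] by (cases n) (auto simp: K'_def)
  qed
  also have "{t. \<exists>z. \<forall>n. \<exists>j. t \<in> A' n j \<and> z \<in> K' n j} = {t \<in> space M. \<exists>y. (t, y) \<in> G}"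
  proof (intro equalityI subsetI)
    fix t assume "t \<in> {t. \<exists>z. \<forall>n. \<exists>j. t \<in> A' n j \<and> z \<in> K' n j}"
    then obtain y e where z: "\<And>n. \<exists>j. t \<in> A' n j \<and> (y, e) \<in> K' n j" by auto
    have "\<exists>j. t \<in> A n j \<and> (y, e) \<in> K n j" for n using z[of "Suc n"] by (simp add: A'_def K'_def)
    moreover have "t \<in> space M" "e \<in> hilbert_cube" using z[of 0] by (auto simp: A'_def K'_def)
    ultimately show "t \<in> {t \<in> space M. \<exists>y. (t, y) \<in> G}" by (auto simp: Geq)
  next
    fix t assume "t \<in> {t \<in> space M. \<exists>y. (t, y) \<in> G}"
    then obtain y e where t: "t \<in> space M" "e \<in> hilbert_cube"
        "\<And>n. \<exists>j. t \<in> A n j \<and> (y, e) \<in> K n j" by (auto simp: Geq)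
    obtain j where "norm y \<le> real j" using real_arch_simple by blast
    then have "\<exists>j. t \<in> A' n j \<and> (y, e) \<in> K' n j" for n
      using t by (cases n) (auto simp: A'_def K'_def)
    then show "t \<in> {t. \<exists>z. \<forall>n. \<exists>j. t \<in> A' n j \<and> z \<in> K' n j}" by blast
  qed
  finally show ?thesis .
qed

section \<open>Measurable selection of minimizers\<close>

text \<open>
  A point \<open>(t, z)\<close> of \<open>G\<close> fails to be minimal iff a rational number lies strictly between a value
  of \<open>h\<close> attained in the same fibre and \<open>h (t, z)\<close>; the values of \<open>t\<close> for which the fibre attains
  a value below a given rational form a projection.
\<close>

lemma argmin_graph_measurable:
  fixes G :: "('t \<times> 'b::euclidean_space) set" and h :: "'t \<times> 'b \<Rightarrow> real"
  assumes "complete_measure M" "finite_measure M"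
    and G: "G \<in> sets (M \<Otimes>\<^sub>M borel)" and h: "h \<in> borel_measurable (M \<Otimes>\<^sub>M borel)"
  shows "{(t, z) \<in> G. \<forall>w. (t, w) \<in> G \<longrightarrow> h (t, z) \<le> h (t, w)} \<in> sets (M \<Otimes>\<^sub>M borel)"
proof -
  define P where "P q = {t \<in> space M. \<exists>w. (t, w) \<in> {p \<in> G. h p < real_of_rat q}}" for q
  have below: "{p \<in> G. h p < c} \<in> sets (M \<Otimes>\<^sub>M borel)" for c
  proof -
    have "{p \<in> G. h p < c} = G \<inter> {p \<in> space (M \<Otimes>\<^sub>M borel). h p < c}"
      using sets.sets_into_space[OF G] by auto
    then show ?thesis using G h by simp
  qed
  have above: "{p \<in> G. c < h p} \<in> sets (M \<Otimes>\<^sub>M borel)" for c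
  proof -
    have "{p \<in> G. c < h p} = G \<inter> {p \<in> space (M \<Otimes>\<^sub>M borel). c < h p}"
      using sets.sets_into_space[OF G] by auto
    then show ?thesis using G h by simp
  qed
  have P: "P q \<in> sets M" for q
    unfolding P_def by (rule measurable_projection[OF assms(1,2) below])
  have "{(t, z) \<in> G. \<forall>w. (t, w) \<in> G \<longrightarrow> h (t, z) \<le> h (t, w)} =
      G - (\<Union>q. {p \<in> G. real_of_rat q < h p} \<inter> P q \<times> UNIV)" (is "?L = ?R")
  proof (intro equalityI subsetI)
    fix p assume "p \<in> ?L"
    then show "p \<in> ?R" by (fastforce simp: P_def)
  next
    fix p assume p: "p \<in> ?R"
    obtain t z where tz: "p = (t, z)" by (cases p)
    have "h (t, z) \<le> h (t, w)" if w: "(t, w) \<in> G" for w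
    proof (rule ccontr)
      assume "\<not> h (t, z) \<le> h (t, w)"
      then obtain q where q: "h (t, w) < real_of_rat q" "real_of_rat q < h (t, z)"
        using of_rat_dense[of "h (t, w)" "h (t, z)"] by auto
      have "t \<in> space M" using sets.sets_into_space[OF G] w by (auto simp: space_pair_measure)
      then have "t \<in> P q" using q(1) w by (auto simp: P_def)
      then show False using p q(2) tz by auto
    qed
    then show "p \<in> ?L" using p tz by auto
  qed
  also have "\<dots> \<in> sets (M \<Otimes>\<^sub>M borel)"
    by (intro sets.Diff G sets.countable_UN'' sets.Int above pair_measureI P) auto
  finally show ?thesis .
qed

lemma argmin_coercive:
  fixes S :: "'b::euclidean_space set" and f :: "'b \<Rightarrow> real"
  assumes "closed S" "S \<noteq> {}" "continuous_on UNIV f" "\<And>c. bounded {z. f z \<le> c}"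
  shows "{z \<in> S. \<forall>w\<in>S. f z \<le> f w} \<noteq> {}" "compact {z \<in> S. \<forall>w\<in>S. f z \<le> f w}"
proof -
  obtain w0 where w0: "w0 \<in> S" using assms by blast
  have cl: "closed {z. f z \<le> c}" for c
    using assms(3) by (intro closed_Collect_le) auto
  have "compact (S \<inter> {z. f z \<le> f w0})"
    using assms(1,4) cl by (auto simp: compact_eq_bounded_closed intro!: closed_Int bounded_Int)
  then obtain z where z: "z \<in> S" "f z \<le> f w0" "\<And>w. w \<in> S \<Longrightarrow> f w \<le> f w0 \<Longrightarrow> f z \<le> f w"
    using continuous_attains_inf[of "S \<inter> {z. f z \<le> f w0}" f] w0
      continuous_on_subset[OF assms(3)] by blast
  have "f z \<le> f w" if "w \<in> S" for w
    using z(2) z(3)[OF that] by linarith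
  then show "{z \<in> S. \<forall>w\<in>S. f z \<le> f w} \<noteq> {}" using z(1) by blast
  have "{z \<in> S. \<forall>w\<in>S. f z \<le> f w} = S \<inter> (\<Inter>w\<in>S. {z. f z \<le> f w})" by auto
  also have "\<dots> = (S \<inter> {z. f z \<le> f w0}) \<inter> (\<Inter>w\<in>S. {z. f z \<le> f w})" using w0 by auto
  also have "compact \<dots>"
    by (intro compact_Int_closed[OF \<open>compact (S \<inter> {z. f z \<le> f w0})\<close>] closed_INT ballI cl)
  finally show "compact {z \<in> S. \<forall>w\<in>S. f z \<le> f w}" .
qed

lemma argmin_compact:
  fixes S :: "'b::euclidean_space set" and f :: "'b \<Rightarrow> real"
  assumes "compact S" "continuous_on UNIV f"
  shows "S \<noteq> {} \<Longrightarrow> {z \<in> S. \<forall>w\<in>S. f z \<le> f w} \<noteq> {}" "compact {z \<in> S. \<forall>w\<in>S. f z \<le> f w}"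
proof -
  show "{z \<in> S. \<forall>w\<in>S. f z \<le> f w} \<noteq> {}" if "S \<noteq> {}"
    using continuous_attains_inf[OF assms(1) that continuous_on_subset[OF assms(2)]] by auto
  have "{z \<in> S. \<forall>w\<in>S. f z \<le> f w} = S \<inter> (\<Inter>w\<in>S. {z. f z \<le> f w})" by auto
  also have "compact \<dots>"
    using assms(2)
    by (intro compact_Int_closed[OF assms(1)] closed_INT ballI closed_Collect_le continuous_on_const)
  finally show "compact {z \<in> S. \<forall>w\<in>S. f z \<le> f w}" .
qed

text \<open>
  Minimizing successively all coordinates shrinks each nonempty fibre to its lexicographically
  smallest point without losing measurability of the graph. A function with measurable graph is
  measurable because preimages of Borel sets are projections.
\<close>

lemma measurable_selection_compact:
  fixes G :: "('t \<times> 'b::euclidean_space) set"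
  assumes cpl: "complete_measure M" and fin: "finite_measure M"
    and G: "G \<in> sets (M \<Otimes>\<^sub>M borel)" and cpt: "\<And>t. compact {z. (t, z) \<in> G}"
  obtains g where "g \<in> borel_measurable M" "\<And>t z. (t, z) \<in> G \<Longrightarrow> (t, g t) \<in> G"
proof -
  have "\<exists>G'\<subseteq>G. G' \<in> sets (M \<Otimes>\<^sub>M borel) \<and> (\<forall>t. compact {z. (t, z) \<in> G'}) \<and>
      (\<forall>t z. (t, z) \<in> G \<longrightarrow> (\<exists>w. (t, w) \<in> G')) \<and>
      (\<forall>b\<in>B. \<forall>t z w. (t, z) \<in> G' \<longrightarrow> (t, w) \<in> G' \<longrightarrow> inner z b = inner w b)"
    if "finite B" for B :: "'b set"
    using that
  proof induction
    case empty
    show ?case using G cpt by (intro exI[of _ G]) auto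
  next
    case (insert b B)
    then obtain H where H: "H \<subseteq> G" "H \<in> sets (M \<Otimes>\<^sub>M borel)" "\<And>t. compact {z. (t, z) \<in> H}"
      "\<And>t z. (t, z) \<in> G \<Longrightarrow> \<exists>w. (t, w) \<in> H"
      "\<And>c t z w. c \<in> B \<Longrightarrow> (t, z) \<in> H \<Longrightarrow> (t, w) \<in> H \<Longrightarrow> inner z c = inner w c"
      by blast
    define H' where "H' = {(t, z) \<in> H. \<forall>w. (t, w) \<in> H \<longrightarrow> inner z b \<le> inner w b}"
    have sec: "{z. (t, z) \<in> H'} = {z \<in> {z. (t, z) \<in> H}. \<forall>w\<in>{z. (t, z) \<in> H}. inner z b \<le> inner w b}"
      for t by (auto simp: H'_def)
    have mH: "H' \<in> sets (M \<Otimes>\<^sub>M borel)"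
      using argmin_graph_measurable[OF cpl fin H(2), of "\<lambda>p. inner (snd p) b"]
      by (simp add: H'_def)
    have cH: "compact {z. (t, z) \<in> H'}" for t
      unfolding sec by (rule argmin_compact(2)[OF H(3)]) (intro continuous_intros)
    have nH: "\<exists>w. (t, w) \<in> H'" if "(t, z) \<in> G" for t z
    proof -
      have "{z. (t, z) \<in> H} \<noteq> {}" using H(4)[OF that] by blast
      then have "{z. (t, z) \<in> H'} \<noteq> {}"
        unfolding sec by (rule argmin_compact(1)[OF H(3), rotated]) (intro continuous_intros)
      then show ?thesis by blast
    qed
    have iH: "inner z c = inner w c"
      if "c \<in> insert b B" "(t, z) \<in> H'" "(t, w) \<in> H'" for c t z w
      using that H(5)[of c t z w] by (auto simp: H'_def intro: antisym)
    have sH: "H' \<subseteq> G" using H(1) by (auto simp: H'_def)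
    show ?case
      by (intro exI[of _ H'] conjI ballI allI impI sH mH cH) (blast intro: nH iH)+
  qed
  from this[OF finite_Basis] obtain H where HB: "H \<subseteq> G \<and> H \<in> sets (M \<Otimes>\<^sub>M borel) \<and>
      (\<forall>t. compact {z. (t, z) \<in> H}) \<and> (\<forall>t z. (t, z) \<in> G \<longrightarrow> (\<exists>w. (t, w) \<in> H)) \<and>
      (\<forall>b\<in>Basis. \<forall>t z w. (t, z) \<in> H \<longrightarrow> (t, w) \<in> H \<longrightarrow> inner z b = inner w b)" ..
  have H: "H \<subseteq> G" "H \<in> sets (M \<Otimes>\<^sub>M borel)" using HB by simp_all
  have HG: "\<exists>w. (t, w) \<in> H" if "(t, z) \<in> G" for t z
    using HB[THEN conjunct2, THEN conjunct2, THEN conjunct2, THEN conjunct1] that by blast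
  have coord: "inner z b = inner w b" if "b \<in> Basis" "(t, z) \<in> H" "(t, w) \<in> H" for b t z w
    by (rule HB[THEN conjunct2, THEN conjunct2, THEN conjunct2, THEN conjunct2, rule_format]) fact+
  have uniq: "z = w" if "(t, z) \<in> H" "(t, w) \<in> H" for t z w
    using coord[OF _ that] by (rule euclidean_eqI)
  define D where "D = {t \<in> space M. \<exists>z. (t, z) \<in> H}"
  define g where "g t = (if t \<in> D then SOME z. (t, z) \<in> H else 0)" for t
  have gH: "(t, g t) \<in> H" if "t \<in> D" for t
  proof -
    have "\<exists>z. (t, z) \<in> H" using that by (simp add: D_def)
    from someI_ex[OF this] show ?thesis using that by (simp add: g_def)
  qed
  have D: "D \<in> sets M" unfolding D_def by (rule measurable_projection[OF cpl fin H(2)])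
  show thesis
  proof (rule that)
    show "g \<in> borel_measurable M"
    proof (rule measurableI)
      fix C :: "'b set" assume C: "C \<in> sets borel"
      have "g -` C \<inter> space M = {t \<in> space M. \<exists>z. (t, z) \<in> H \<inter> space M \<times> C} \<union>
          (if 0 \<in> C then space M - D else {})"
      proof (intro equalityI subsetI)
        fix t assume t: "t \<in> g -` C \<inter> space M"
        show "t \<in> {t \<in> space M. \<exists>z. (t, z) \<in> H \<inter> space M \<times> C} \<union> (if 0 \<in> C then space M - D else {})"
        proof (cases "t \<in> D")
          case True
          then show ?thesis using t gH[OF True] by blast
        next
          case False
          then have "g t = 0" by (simp add: g_def)
          then show ?thesis using t False by auto
        qed
      next
        fix t assume t: "t \<in> {t \<in> space M. \<exists>z. (t, z) \<in> H \<inter> space M \<times> C} \<union>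
            (if 0 \<in> C then space M - D else {})"
        show "t \<in> g -` C \<inter> space M"
        proof (cases "t \<in> D")
          case True
          then obtain z where "(t, z) \<in> H" "z \<in> C" using t by (auto split: if_splits)
          then show ?thesis using uniq[OF gH[OF True], of z] True by (auto simp: D_def)
        next
          case False
          then have "g t = 0" by (simp add: g_def)
          moreover have "0 \<in> C \<and> t \<in> space M" using t False by (auto simp: D_def split: if_splits)
          ultimately show ?thesis by simp
        qed
      qed
      also have "\<dots> \<in> sets M"
        using D by (intro sets.Un measurable_projection[OF cpl fin] sets.Int H pair_measureI C) auto
      finally show "g -` C \<inter> space M \<in> sets M" .
    qed simp
  next
    fix t z assume "(t, z) \<in> G"
    then have "t \<in> D"
      using HG sets.sets_into_space[OF G] by (auto simp: D_def space_pair_measure)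
    then show "(t, g t) \<in> G" using gH H(1) by blast
  qed
qed

lemma measurable_argmin_selection:
  fixes G :: "('t \<times> 'b::euclidean_space) set" and h :: "'t \<times> 'b \<Rightarrow> real"
  assumes cpl: "complete_measure M" and fin: "finite_measure M"
    and G: "G \<in> sets (M \<Otimes>\<^sub>M borel)" and cl: "\<And>t. t \<in> space M \<Longrightarrow> closed {z. (t, z) \<in> G}"
    and h: "h \<in> borel_measurable (M \<Otimes>\<^sub>M borel)"
    and cont: "\<And>t. t \<in> space M \<Longrightarrow> continuous_on UNIV (\<lambda>z. h (t, z))"
    and coercive: "\<And>t c. t \<in> space M \<Longrightarrow> bounded {z. h (t, z) \<le> c}"
  obtains g where "g \<in> borel_measurable M"
    "\<And>t z. (t, z) \<in> G \<Longrightarrow> (t, g t) \<in> G \<and> h (t, g t) \<le> h (t, z)"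
proof -
  define H where "H = {(t, z) \<in> G. \<forall>w. (t, w) \<in> G \<longrightarrow> h (t, z) \<le> h (t, w)}"
  have sec: "{z. (t, z) \<in> H} =
      {z \<in> {z. (t, z) \<in> G}. \<forall>w\<in>{z. (t, z) \<in> G}. h (t, z) \<le> h (t, w)}" for t
    by (auto simp: H_def)
  have sp: "t \<in> space M" if "(t, z) \<in> G" for t z
    using that sets.sets_into_space[OF G] by (auto simp: space_pair_measure)
  have ne: "{z. (t, z) \<in> H} \<noteq> {}" if "(t, z) \<in> G" for t z
    unfolding sec using that sp[OF that] by (intro argmin_coercive(1) cl cont coercive) auto
  have "compact {z. (t, z) \<in> H}" for t
  proof (cases "{z. (t, z) \<in> G} = {}")
    case True
    then have "{z. (t, z) \<in> H} = {}" by (auto simp: H_def)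
    then show ?thesis by simp
  next
    case False
    then obtain z where "(t, z) \<in> G" by blast
    from sp[OF this] False show ?thesis
      unfolding sec by (intro argmin_coercive(2) cl cont coercive) auto
  qed
  moreover have "H \<in> sets (M \<Otimes>\<^sub>M borel)"
    unfolding H_def by (rule argmin_graph_measurable[OF cpl fin G h])
  ultimately obtain g where g: "g \<in> borel_measurable M" "\<And>t z. (t, z) \<in> H \<Longrightarrow> (t, g t) \<in> H"
    using measurable_selection_compact[OF cpl fin] by metis
  show thesis
  proof (rule that)
    show "(t, g t) \<in> G \<and> h (t, g t) \<le> h (t, z)" if tz: "(t, z) \<in> G" for t z
    proof -
      obtain w where "(t, w) \<in> H" using ne[OF tz] by blast
      from g(2)[OF this] show ?thesis using tz by (auto simp: H_def)
    qed
  qed (fact g(1))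
qed

section \<open>Steep coderivatives at minimizers of a penalty\<close>

text \<open>
  Fermat's rule: at a minimizer over \<open>C\<close> the negative gradient makes an obtuse angle with every
  direction that is tangent to \<open>C\<close>.
\<close>

lemma fermat_rule_frechet:
  fixes p :: "'a::real_inner" and h :: "'a \<Rightarrow> real"
  assumes "p \<in> C" and deriv: "(h has_derivative (\<lambda>d. inner g d)) (at p)"
    and min: "\<And>q. q \<in> C \<Longrightarrow> h p \<le> h q"
  shows "- g \<in> frechet_normal_cone p C"
proof -
  have "Limsup (at p within C) (\<lambda>q. ereal (inner (- g) (q - p) / norm (q - p))) \<le> 0 + ereal e"
    if e: "e > 0" for e :: real
  proof (rule Limsup_bounded)
    obtain d where d: "d > 0"
        "\<And>q. norm (q - p) < d \<Longrightarrow> norm (h q - h p - inner g (q - p)) \<le> e * norm (q - p)"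
      using deriv[unfolded has_derivative_at_alt, THEN conjunct2, rule_format, OF e] by auto
    have "inner (- g) (q - p) / norm (q - p) \<le> e" if q: "q \<in> C" "q \<noteq> p" "norm (q - p) < d" for q
    proof -
      have "inner (- g) (q - p) \<le> e * norm (q - p)"
        using d(2)[OF q(3)] min[OF q(1)] by (simp add: abs_le_iff)
      then show ?thesis using q(2) by (subst pos_divide_le_eq) auto
    qed
    then show "\<forall>\<^sub>F q in at p within C. ereal (inner (- g) (q - p) / norm (q - p)) \<le> 0 + ereal e"
      unfolding eventually_at using d(1) by (auto simp: dist_norm intro!: exI[of _ d])
  qed
  then have "Limsup (at p within C) (\<lambda>q. ereal (inner (- g) (q - p) / norm (q - p))) \<le> 0"
    by (rule ereal_le_epsilon2)
  then show ?thesis using \<open>p \<in> C\<close> by (simp add: frechet_normal_cone_def)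
qed

lemma frechet_normal_cone_subset_normal_cone: "frechet_normal_cone p C \<subseteq> normal_cone p C"
proof
  fix xs assume "xs \<in> frechet_normal_cone p C"
  then show "xs \<in> normal_cone p C"
    unfolding normal_cone_def
    by (intro CollectI exI[of _ "\<lambda>_::nat. p"] exI[of _ "\<lambda>_::nat. xs"] conjI allI tendsto_const)
qed

text \<open>
  The distance of \<open>p\<close> from \<open>(v, y)\<close>, with weight \<open>c\<close> on the first component. The distance in the
  second component is smoothed by \<open>\<epsilon>\<close> so that the function is differentiable at every point whose
  first component differs from \<open>v\<close>; hence Fermat's rule needs no calculus of nonsmooth sums.
\<close>

definition penalty :: "real \<Rightarrow> real \<Rightarrow> 'a::real_inner \<Rightarrow> 'b::real_inner \<Rightarrow> 'a \<times> 'b \<Rightarrow> real" where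
  "penalty c \<epsilon> v y p = c * norm (fst p - v) + sqrt (\<epsilon>\<^sup>2 + (norm (snd p - y))\<^sup>2)"

lemma penalty_has_derivative:
  fixes v x :: "'a::real_inner" and y z :: "'b::real_inner"
  assumes "x \<noteq> v" "\<epsilon> > 0"
  shows "(penalty c \<epsilon> v y has_derivative
     inner ((c / norm (x - v)) *\<^sub>R (x - v), (1 / sqrt (\<epsilon>\<^sup>2 + (norm (z - y))\<^sup>2)) *\<^sub>R (z - y)))
     (at (x, z))"
proof -
  have pos: "\<epsilon>\<^sup>2 + inner (z - y) (z - y) > 0"
    using assms(2) by (intro add_pos_nonneg) auto
  have d1: "((\<lambda>p. norm (fst p - v)) has_derivative (\<lambda>d. inner (fst d) (sgn (x - v)))) (at (x, z))"
    by (rule has_derivative_compose[of "\<lambda>p. fst p - v" "\<lambda>d. fst d" "(x,z)" UNIV norm, simplified])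
       (use assms in \<open>auto intro!: derivative_eq_intros has_derivative_norm\<close>)
  have d2: "((\<lambda>p. sqrt (\<epsilon>\<^sup>2 + inner (snd p - y) (snd p - y))) has_derivative
     (\<lambda>d. inner (z - y) (snd d) / sqrt (\<epsilon>\<^sup>2 + inner (z - y) (z - y)))) (at (x, z))"
    using pos by (auto intro!: derivative_eq_intros simp: inner_commute field_simps)
  have "(penalty c \<epsilon> v y has_derivative
     (\<lambda>d. c * inner (fst d) (sgn (x - v)) + inner (z - y) (snd d) / sqrt (\<epsilon>\<^sup>2 + inner (z - y) (z - y))))
     (at (x, z))"
    unfolding penalty_def power2_norm_eq_inner
    by (intro has_derivative_add has_derivative_mult_right d1 d2)
  moreover have "(\<lambda>d. c * inner (fst d) (sgn (x - v)) +
       inner (z - y) (snd d) / sqrt (\<epsilon>\<^sup>2 + inner (z - y) (z - y))) =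
     inner ((c / norm (x - v)) *\<^sub>R (x - v), (1 / sqrt (\<epsilon>\<^sup>2 + (norm (z - y))\<^sup>2)) *\<^sub>R (z - y))"
    by (auto simp: inner_prod_def sgn_div_norm power2_norm_eq_inner inner_commute divide_inverse)
  ultimately show ?thesis by simp
qed

text \<open>
  The coderivative element found here has norm \<open>c\<close>, while its argument has norm at most \<open>1\<close>. If the
  coderivative of \<open>F\<close> is bounded by a modulus smaller than \<open>c\<close>, then minimizers of the penalty over the
  graph must have first component \<open>v\<close>, i.e. they are points of \<open>F v\<close>.
\<close>

lemma steep_coderivative_at_penalty_minimizer:
  assumes "z \<in> F x" "x \<noteq> v" "\<epsilon> > 0"
    and "\<And>x' z'. z' \<in> F x' \<Longrightarrow> penalty c \<epsilon> v y (x, z) \<le> penalty c \<epsilon> v y (x', z')"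
  shows "- ((c / norm (x - v)) *\<^sub>R (x - v)) \<in>
     coderivative F x z ((1 / sqrt (\<epsilon>\<^sup>2 + (norm (z - y))\<^sup>2)) *\<^sub>R (z - y))"
proof -
  have "- ((c / norm (x - v)) *\<^sub>R (x - v), (1 / sqrt (\<epsilon>\<^sup>2 + (norm (z - y))\<^sup>2)) *\<^sub>R (z - y))
      \<in> frechet_normal_cone (x, z) (graph_of F)"
    using assms(1,4)
    by (intro fermat_rule_frechet[OF _ penalty_has_derivative[OF assms(2,3)]])
       (auto simp: graph_of_def)
  then show ?thesis
    using frechet_normal_cone_subset_normal_cone unfolding coderivative_def by fastforce
qed

lemma norm_smoothed_unit_le_1:
  fixes w :: "'b::real_inner"
  shows "norm ((1 / sqrt (\<epsilon>\<^sup>2 + (norm w)\<^sup>2)) *\<^sub>R w) \<le> 1"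
proof -
  have "norm w = sqrt ((norm w)\<^sup>2)" by simp
  also have "\<dots> \<le> sqrt (\<epsilon>\<^sup>2 + (norm w)\<^sup>2)" by (intro real_sqrt_le_mono) simp
  finally have "norm w / sqrt (\<epsilon>\<^sup>2 + (norm w)\<^sup>2) \<le> 1"
    by (intro divide_le_eq_1[THEN iffD2]) (auto simp: less_le)
  then show ?thesis by simp
qed

section \<open>Transport of selections\<close>

lemma measurable_graph_vertical:
  assumes "normal_integrand M \<Phi>"
  shows "{(t, z). t \<in> space M \<and> z \<in> \<Phi> t v} \<in> sets (M \<Otimes>\<^sub>M borel)"
    and "t \<in> space M \<Longrightarrow> closed (\<Phi> t v)"
proof -
  let ?f = "\<lambda>p. (fst p, v, snd p)"
  have "?f \<in> measurable (M \<Otimes>\<^sub>M borel) (M \<Otimes>\<^sub>M borel)"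
    by (intro measurable_Pair measurable_fst measurable_compose[OF measurable_snd]
        borel_measurable_continuous_onI continuous_intros)
  from measurable_sets[OF this] assms
  have "?f -` {(t, x, y). t \<in> space M \<and> y \<in> \<Phi> t x} \<inter> space (M \<Otimes>\<^sub>M borel) \<in> sets (M \<Otimes>\<^sub>M borel)"
    unfolding normal_integrand_def by blast
  moreover have "?f -` {(t, x, y). t \<in> space M \<and> y \<in> \<Phi> t x} \<inter> space (M \<Otimes>\<^sub>M borel) =
      {(t, z). t \<in> space M \<and> z \<in> \<Phi> t v}"
    by (auto simp: space_pair_measure)
  ultimately show "{(t, z). t \<in> space M \<and> z \<in> \<Phi> t v} \<in> sets (M \<Otimes>\<^sub>M borel)" by simp
next
  assume "t \<in> space M"
  then have "closed ((\<lambda>z. (v, z)) -` graph_of (\<Phi> t))"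
    using assms by (intro closed_vimage continuous_intros) (auto simp: normal_integrand_def)
  then show "closed (\<Phi> t v)" by (simp add: graph_of_def vimage_def)
qed

lemma bounded_penalty_sublevel:
  fixes v :: "'a::euclidean_space" and y :: "'b::euclidean_space"
  assumes "1 \<le> c"
  shows "bounded {p. penalty c \<epsilon> v y p \<le> r}"
proof (rule bounded_subset)
  show "{p. penalty c \<epsilon> v y p \<le> r} \<subseteq> cball v r \<times> cball y r"
  proof
    fix p assume "p \<in> {p. penalty c \<epsilon> v y p \<le> r}"
    then have r: "c * norm (fst p - v) + sqrt (\<epsilon>\<^sup>2 + (norm (snd p - y))\<^sup>2) \<le> r"
      by (simp add: penalty_def)
    have "norm (snd p - y) \<le> sqrt (\<epsilon>\<^sup>2 + (norm (snd p - y))\<^sup>2)"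
      by (rule real_le_rsqrt) simp
    moreover have "1 * norm (fst p - v) \<le> c * norm (fst p - v)"
      using assms by (intro mult_right_mono) auto
    ultimately have "norm (fst p - v) \<le> r" "norm (snd p - y) \<le> r"
      using r norm_ge_zero[of "fst p - v"] norm_ge_zero[of "snd p - y"] by linarith+
    then show "p \<in> cball v r \<times> cball y r"
      by (cases p) (auto simp: dist_norm norm_minus_commute)
  qed
qed (auto intro!: bounded_Times)

text \<open>
  A minimizer does at least as well as the starting point \<open>(u, y)\<close>, so it stays close to it.
\<close>

lemma penalty_bounds:
  assumes "penalty c \<epsilon> v y (x, z) \<le> penalty c \<epsilon> v y (u, y)" "\<epsilon> > 0" "c \<ge> 1"
  shows "norm (x - v) \<le> norm (u - v)" "norm (z - y) \<le> c * norm (u - v) + \<epsilon>"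
proof -
  let ?s = "sqrt (\<epsilon>\<^sup>2 + (norm (z - y))\<^sup>2)"
  have s: "c * norm (x - v) + ?s \<le> c * norm (u - v) + \<epsilon>"
    using assms(1,2) by (simp add: penalty_def)
  have "norm (z - y) \<le> ?s" "\<epsilon> \<le> ?s" by (auto intro!: real_le_rsqrt)
  moreover have "0 \<le> c * norm (x - v)" using assms(3) by simp
  ultimately show "norm (z - y) \<le> c * norm (u - v) + \<epsilon>" using s by linarith
  have "c * norm (x - v) \<le> c * norm (u - v)" using s \<open>\<epsilon> \<le> ?s\<close> by linarith
  then show "norm (x - v) \<le> norm (u - v)" using assms(3) by simp
qed

lemma integrable_perturbation:
  fixes f g :: "'t \<Rightarrow> 'b::euclidean_space"
  assumes "integrable M f" "g \<in> borel_measurable M" "integrable M k"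
    "AE t in M. norm (g t - f t) \<le> k t"
  shows "integrable M g" "norm_L1 M (\<lambda>t. g t - f t) \<le> (\<integral>t. k t \<partial>M)"
proof -
  have d: "integrable M (\<lambda>t. g t - f t)"
    by (rule Bochner_Integration.integrable_bound[OF assms(3)])
       (use assms in \<open>auto elim!: eventually_mono intro: borel_measurable_diff borel_measurable_integrable\<close>)
  from Bochner_Integration.integrable_add[OF d assms(1)] show "integrable M g" by simp
  show "norm_L1 M (\<lambda>t. g t - f t) \<le> (\<integral>t. k t \<partial>M)"
    unfolding norm_L1_def using assms d by (intro integral_mono_AE integrable_norm) auto
qed

text \<open>
  Moves a selection \<open>Y\<close> of \<open>\<Phi>\<close> at \<open>u\<close> to a selection at \<open>v\<close>. For each \<open>t\<close> the penalty around
  \<open>(v, Y t)\<close> with weight \<open>l t + 1\<close> is minimized over the graph of \<open>\<Phi> t\<close>, and the minimizer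
  \<open>(x t, z t)\<close> is chosen measurably. The estimates for minimizers put the pair \<open>(x, z)\<close> into the
  region where the coderivatives are controlled by \<open>l\<close>. Wherever \<open>x t \<noteq> v\<close> the coderivative has an
  element of norm \<open>l t + 1\<close> over an argument of norm at most \<open>1\<close>, so this happens only on a null set.
\<close>

lemma quasi_lipschitzian_selection:
  fixes \<Phi> :: "'t \<Rightarrow> 'a::euclidean_space \<Rightarrow> 'b::euclidean_space set"
  assumes cpl: "complete_measure M" and fin: "finite_measure M" and norm: "normal_integrand M \<Phi>"
    and l: "integrable M l" "\<And>t. t \<in> space M \<Longrightarrow> 0 \<le> l t"
    and quasi: "\<And>x y ys. x \<in> Linfty M \<Longrightarrow> ys \<in> Linfty M \<Longrightarrow>
          (AE t in M. norm (x t - xbar) \<le> \<eta>) \<Longrightarrow>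
          integrable M y \<Longrightarrow> norm_L1 M (\<lambda>t. y t - f t) \<le> \<eta> \<Longrightarrow>
          (AE t in M. y t \<in> \<Phi> t (x t)) \<Longrightarrow>
          (AE t in M. \<forall>xs\<in>coderivative (\<Phi> t) (x t) (y t) (ys t). norm xs \<le> l t * norm (ys t))"
    and f: "integrable M f" and Y: "integrable M Y" "AE t in M. Y t \<in> \<Phi> t u"
    and close: "norm (v - xbar) + norm (u - v) \<le> \<eta>"
      "norm_L1 M (\<lambda>t. Y t - f t) + (\<integral>t. l t + 2 \<partial>M) * norm (u - v) \<le> \<eta>"
  obtains z where "z \<in> borel_measurable M" "AE t in M. z t \<in> \<Phi> t v"
    "AE t in M. norm (z t - Y t) \<le> (l t + 2) * norm (u - v)"
proof (cases "u = v")
  case True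
  then show thesis using Y by (intro that[of Y]) auto
next
  case False
  interpret finite_measure M by fact
  \<comment> \<open>The smoothing is proportional to the step, so its error only adds \<open>1\<close> to the modulus.\<close>
  define \<epsilon> where "\<epsilon> = norm (u - v)"
  have eps: "\<epsilon> > 0" using False by (simp add: \<epsilon>_def)
  define h where "h p = penalty (l (fst p) + 1) \<epsilon> v (Y (fst p)) (snd p)" for p
  let ?G = "{(t, p). t \<in> space M \<and> p \<in> graph_of (\<Phi> t)}"
  have G: "?G \<in> sets (M \<Otimes>\<^sub>M borel)"
    using norm by (simp add: normal_integrand_def graph_of_def case_prod_beta')
  have Ym: "Y \<in> borel_measurable M" and lm: "l \<in> borel_measurable M"
    using Y l by auto
  have [measurable]: "(\<lambda>p. l (fst p)) \<in> borel_measurable (M \<Otimes>\<^sub>M (borel :: ('a \<times> 'b) measure))"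
    "(\<lambda>p. Y (fst p)) \<in> borel_measurable (M \<Otimes>\<^sub>M (borel :: ('a \<times> 'b) measure))"
    "(\<lambda>p. fst (snd p)) \<in> borel_measurable (M \<Otimes>\<^sub>M (borel :: ('a \<times> 'b) measure))"
    "(\<lambda>p. snd (snd p)) \<in> borel_measurable (M \<Otimes>\<^sub>M (borel :: ('a \<times> 'b) measure))"
    by (intro measurable_compose[OF measurable_fst] measurable_compose[OF measurable_snd] Ym lm
        borel_measurable_continuous_onI continuous_intros)+
  have hm: "h \<in> borel_measurable (M \<Otimes>\<^sub>M borel)"
    unfolding h_def penalty_def by measurable
  obtain g where g: "g \<in> borel_measurable M"
      "\<And>t p. (t, p) \<in> ?G \<Longrightarrow> (t, g t) \<in> ?G \<and> h (t, g t) \<le> h (t, p)"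
  proof (rule measurable_argmin_selection[OF cpl fin G _ hm])
    fix t c assume t: "t \<in> space M"
    show "closed {p. (t, p) \<in> ?G}" using norm t by (simp add: normal_integrand_def)
    show "continuous_on UNIV (\<lambda>p. h (t, p))"
      unfolding h_def penalty_def by (simp, intro continuous_intros)
    show "bounded {p. h (t, p) \<le> c}"
      unfolding h_def using l(2)[OF t] by (simp add: bounded_penalty_sublevel)
  qed blast
  define x where "x t = fst (g t)" for t
  define z where "z t = snd (g t)" for t
  define ys where "ys t = (1 / sqrt (\<epsilon>\<^sup>2 + (norm (z t - Y t))\<^sup>2)) *\<^sub>R (z t - Y t)" for t
  have xm: "x \<in> borel_measurable M" and zm: "z \<in> borel_measurable M"
    unfolding x_def z_def
    by (intro measurable_compose[OF g(1)] borel_measurable_continuous_onI continuous_intros)+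
  have ysm: "ys \<in> borel_measurable M"
    unfolding ys_def using zm Ym by measurable
  have min: "z t \<in> \<Phi> t (x t) \<and>
      (\<forall>x' z'. z' \<in> \<Phi> t x' \<longrightarrow>
        penalty (l t + 1) \<epsilon> v (Y t) (x t, z t) \<le> penalty (l t + 1) \<epsilon> v (Y t) (x', z')) \<and>
      norm (x t - v) \<le> norm (u - v) \<and> norm (z t - Y t) \<le> (l t + 2) * norm (u - v)"
    if t: "t \<in> space M" "Y t \<in> \<Phi> t u" for t
  proof -
    have m: "(t, g t) \<in> ?G \<and> h (t, g t) \<le> h (t, (x', z'))" if "z' \<in> \<Phi> t x'" for x' z'
      using g(2)[of t "(x', z')"] that t by (simp add: graph_of_def)
    have m': "penalty (l t + 1) \<epsilon> v (Y t) (x t, z t) \<le> penalty (l t + 1) \<epsilon> v (Y t) (x', z')"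
      if "z' \<in> \<Phi> t x'" for x' z'
      using m[OF that] by (simp add: h_def x_def z_def)
    have "z t \<in> \<Phi> t (x t)" using m[OF t(2)] by (auto simp: graph_of_def x_def z_def)
    moreover have "norm (x t - v) \<le> norm (u - v)" "norm (z t - Y t) \<le> (l t + 1) * norm (u - v) + \<epsilon>"
      using penalty_bounds[OF m'[OF t(2)] eps] l(2)[OF t(1)] by auto
    ultimately show ?thesis using m' by (simp add: \<epsilon>_def algebra_simps)
  qed
  have minAE: "AE t in M. t \<in> space M \<and> Y t \<in> \<Phi> t u"
    using Y(2) AE_space by eventually_elim simp
  have zY: "AE t in M. norm (z t - Y t) \<le> (l t + 2) * norm (u - v)"
    using minAE by eventually_elim (use min in blast)
  have kint: "integrable M (\<lambda>t. (l t + 2) * norm (u - v))"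
    using l(1) by (intro integrable_mult_left Bochner_Integration.integrable_add integrable_const)
  note zint = integrable_perturbation[OF Y(1) zm kint zY]
  have xAE: "AE t in M. norm (x t - xbar) \<le> \<eta>"
    using minAE
  proof eventually_elim
    case (elim t)
    then have "norm (x t - v) \<le> norm (u - v)" using min by blast
    then show ?case using close(1) norm_triangle_ineq[of "x t - v" "v - xbar"] by simp
  qed
  have zf: "norm_L1 M (\<lambda>t. z t - f t) \<le> \<eta>"
  proof -
    have "norm_L1 M (\<lambda>t. z t - f t) \<le> (\<integral>t. norm (z t - Y t) + norm (Y t - f t) \<partial>M)"
      unfolding norm_L1_def using zint(1) Y(1) f
      by (intro integral_mono integrable_norm Bochner_Integration.integrable_add
          Bochner_Integration.integrable_diff norm_diff_triangle_ineq)
         (auto intro: norm_triangle_sub order_trans[OF eq_refl norm_triangle_ineq[of "z _ - Y _" "Y _ - f _"]])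
    also have "\<dots> = norm_L1 M (\<lambda>t. z t - Y t) + norm_L1 M (\<lambda>t. Y t - f t)"
      unfolding norm_L1_def using zint(1) Y(1) f by (intro Bochner_Integration.integral_add) auto
    also have "\<dots> \<le> \<eta>"
      using zint(2) close(2) by simp
    finally show ?thesis .
  qed
  have "AE t in M. \<forall>xs\<in>coderivative (\<Phi> t) (x t) (z t) (ys t). norm xs \<le> l t * norm (ys t)"
  proof (rule quasi[OF _ _ xAE zint(1) zf])
    have "AE t in M. norm (x t) \<le> norm xbar + \<eta>"
      using xAE
    proof eventually_elim
      case (elim t)
      then show ?case using norm_triangle_sub[of "x t" xbar] by simp
    qed
    then show "x \<in> Linfty M" using xm by (auto simp: Linfty_def)
    have "norm (ys t) \<le> 1" for t unfolding ys_def by (rule norm_smoothed_unit_le_1)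
    then show "ys \<in> Linfty M" using ysm by (auto simp: Linfty_def)
    show "AE t in M. z t \<in> \<Phi> t (x t)" using minAE by eventually_elim (use min in blast)
  qed
  with minAE have "AE t in M. z t \<in> \<Phi> t v"
  proof eventually_elim
    case (elim t)
    have "x t = v"
    proof (rule ccontr)
      assume xv: "x t \<noteq> v"
      have "- (((l t + 1) / norm (x t - v)) *\<^sub>R (x t - v)) \<in> coderivative (\<Phi> t) (x t) (z t) (ys t)"
        unfolding ys_def
        by (rule steep_coderivative_at_penalty_minimizer[OF _ xv eps]) (use elim min in blast)+
      then have "norm (- (((l t + 1) / norm (x t - v)) *\<^sub>R (x t - v))) \<le> l t * norm (ys t)"
        using elim by blast
      moreover have "norm (- (((l t + 1) / norm (x t - v)) *\<^sub>R (x t - v))) = l t + 1"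
        using xv elim l(2)[of t] by simp
      moreover have "l t * norm (ys t) \<le> l t * 1"
        using elim l(2) unfolding ys_def by (intro mult_left_mono norm_smoothed_unit_le_1) auto
      ultimately show False by simp
    qed
    then show ?case using min elim by metis
  qed
  then show thesis using zm zY by (intro that)
qed

text \<open>
  If \<open>\<Phi> t v\<close> has some point within \<open>k t\<close> of \<open>Y t\<close>, then so is the nearest one, which can be chosen
  measurably.
\<close>

lemma lipschitzian_selection:
  fixes \<Phi> :: "'t \<Rightarrow> 'a::euclidean_space \<Rightarrow> 'b::euclidean_space set"
  assumes cpl: "complete_measure M" and fin: "finite_measure M" and norm: "normal_integrand M \<Phi>"
    and Y: "integrable M Y" and near: "AE t in M. \<exists>w\<in>\<Phi> t v. norm (w - Y t) \<le> k t"
  obtains z where "z \<in> borel_measurable M" "AE t in M. z t \<in> \<Phi> t v"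
    "AE t in M. norm (z t - Y t) \<le> k t"
proof -
  let ?G = "{(t, z). t \<in> space M \<and> z \<in> \<Phi> t v}"
  have [measurable]: "Y \<in> borel_measurable M" using Y by auto
  have hm: "(\<lambda>p. norm (snd p - Y (fst p))) \<in> borel_measurable (M \<Otimes>\<^sub>M borel)" by measurable
  obtain g where g: "g \<in> borel_measurable M"
      "\<And>t w. (t, w) \<in> ?G \<Longrightarrow> (t, g t) \<in> ?G \<and>
         norm (snd (t, g t) - Y (fst (t, g t))) \<le> norm (snd (t, w) - Y (fst (t, w)))"
  proof (rule measurable_argmin_selection[OF cpl fin measurable_graph_vertical(1)[OF norm] _ hm])
    fix t c assume t: "t \<in> space M"
    show "closed {z. (t, z) \<in> ?G}" using measurable_graph_vertical(2)[OF norm t] t by simp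
    show "continuous_on UNIV (\<lambda>z. norm (snd (t, z) - Y (fst (t, z))))"
      by (simp, intro continuous_intros)
    have "{z. norm (snd (t, z) - Y (fst (t, z))) \<le> c} = cball (Y t) c"
      by (auto simp: dist_norm norm_minus_commute)
    then show "bounded {z. norm (snd (t, z) - Y (fst (t, z))) \<le> c}" by simp
  qed blast
  have "AE t in M. g t \<in> \<Phi> t v \<and> norm (g t - Y t) \<le> k t"
    using near AE_space
  proof eventually_elim
    case (elim t)
    then obtain w where "w \<in> \<Phi> t v" "norm (w - Y t) \<le> k t" by blast
    then show ?case using g(2)[of t w] elim by auto
  qed
  then show thesis by (intro that[OF g(1)]) (auto elim!: eventually_mono)
qed

lemma expected_integral_near:
  fixes Y z :: "'t \<Rightarrow> 'b::euclidean_space"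
  assumes Y: "integrable M Y" and z: "z \<in> borel_measurable M" "AE t in M. z t \<in> \<Phi> t v"
    and k: "integrable M k" "AE t in M. norm (z t - Y t) \<le> k t" "(\<integral>t. k t \<partial>M) \<le> r"
  shows "(\<integral>t. Y t \<partial>M) \<in> expected_integral M \<Phi> v + (\<lambda>b. r *\<^sub>R b) ` cball 0 1"
proof -
  note zi = integrable_perturbation[OF Y z(1) k(1,2)]
  let ?d = "(\<integral>t. Y t \<partial>M) - (\<integral>t. z t \<partial>M)"
  have "norm ?d = norm (\<integral>t. z t - Y t \<partial>M)"
    using zi(1) Y by (simp add: norm_minus_commute)
  also have "\<dots> \<le> norm_L1 M (\<lambda>t. z t - Y t)"
    unfolding norm_L1_def by (rule integral_norm_bound)
  finally have d: "norm ?d \<le> r" using zi(2) k(3) by simp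
  have "?d \<in> (\<lambda>b. r *\<^sub>R b) ` cball 0 1"
  proof (cases "r = 0")
    case True
    then show ?thesis using d by (auto intro!: image_eqI[of _ _ 0])
  next
    case False
    moreover have "0 \<le> r" using d norm_ge_zero order_trans by blast
    ultimately have r: "r > 0" by simp
    have "norm ((1 / r) *\<^sub>R ?d) \<le> 1" using d r by (simp only: norm_scaleR) simp
    then show ?thesis
      using r by (intro image_eqI[of _ _ "(1 / r) *\<^sub>R ?d"]) (auto simp del: scaleR_diff_right)
  qed
  moreover have "(\<integral>t. z t \<partial>M) \<in> expected_integral M \<Phi> v"
    using zi(1) z(2) by (auto simp: expected_integral_def aumann_integral_def)
  ultimately have "(\<integral>t. z t \<partial>M) + ?d \<in> expected_integral M \<Phi> v + (\<lambda>b. r *\<^sub>R b) ` cball 0 1"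
    by (intro set_plus_intro)
  then show ?thesis by simp
qed

text \<open>
  Along a subsequence the selections converge almost everywhere, and the graphs are closed.
\<close>

lemma selections_closed_L1:
  fixes \<Phi> :: "'t \<Rightarrow> 'a::euclidean_space \<Rightarrow> 'b::euclidean_space set"
  assumes norm: "normal_integrand M \<Phi>" and sel: "\<And>k. Y k \<in> selections M \<Phi> (x k) (y k)"
    and lim: "x \<longlonglongrightarrow> xbar" "y \<longlonglongrightarrow> ybar" and f: "integrable M f"
    and L1: "(\<lambda>k. norm_L1 M (\<lambda>t. Y k t - f t)) \<longlonglongrightarrow> 0"
  shows "f \<in> selections M \<Phi> xbar ybar"
proof -
  have Yi: "integrable M (Y k)" and Yy: "(\<integral>t. Y k t \<partial>M) = y k"
    and Ysel: "AE t in M. Y k t \<in> \<Phi> t (x k)" for k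
    using sel[of k] by (auto simp: selections_def)
  have "(\<lambda>k. y k - (\<integral>t. f t \<partial>M)) \<longlonglongrightarrow> 0"
  proof (rule Lim_null_comparison[OF _ L1])
    have "norm (y k - (\<integral>t. f t \<partial>M)) \<le> norm_L1 M (\<lambda>t. Y k t - f t)" for k
    proof -
      have "norm (y k - (\<integral>t. f t \<partial>M)) = norm (\<integral>t. Y k t - f t \<partial>M)"
        using Yi[of k] f Yy[of k] by simp
      also have "\<dots> \<le> norm_L1 M (\<lambda>t. Y k t - f t)"
        unfolding norm_L1_def by (rule integral_norm_bound)
      finally show ?thesis .
    qed
    then show "\<forall>\<^sub>F k in sequentially. norm (y k - (\<integral>t. f t \<partial>M)) \<le> norm_L1 M (\<lambda>t. Y k t - f t)"
      by simp
  qed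
  then have "(\<integral>t. f t \<partial>M) = ybar" using lim(2) by (metis LIM_zero_cancel LIMSEQ_unique)
  moreover have "AE t in M. f t \<in> \<Phi> t xbar"
  proof -
    obtain r :: "nat \<Rightarrow> nat" where r: "strict_mono r" "AE t in M. (\<lambda>k. Y (r k) t - f t) \<longlonglongrightarrow> 0"
      using tendsto_L1_AE_subseq[of M "\<lambda>k t. Y k t - f t"] Yi f L1 by (auto simp: norm_L1_def)
    have "AE t in M. \<forall>k. Y k t \<in> \<Phi> t (x k)" using Ysel by (simp add: AE_all_countable)
    with r(2) AE_space show ?thesis
    proof eventually_elim
      case (elim t)
      have "closed (graph_of (\<Phi> t))" using norm elim by (simp add: normal_integrand_def)
      moreover have "(x (r k), Y (r k) t) \<in> graph_of (\<Phi> t)" for k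
        using elim by (simp add: graph_of_def)
      moreover have "(\<lambda>k. (x (r k), Y (r k) t)) \<longlonglongrightarrow> (xbar, f t)"
        using LIMSEQ_subseq_LIMSEQ[OF lim(1) r(1)] elim LIM_zero_cancel[of "\<lambda>k. Y (r k) t" "f t"]
        by (intro tendsto_Pair) (auto simp: o_def)
      ultimately have "(xbar, f t) \<in> graph_of (\<Phi> t)"
        by (rule closed_sequentially)
      then show ?case by (simp add: graph_of_def)
    qed
  qed
  ultimately show ?thesis using f by (simp add: selections_def)
qed

section \<open>Lipschitz-likeness of the expected integral\<close>

lemma lipschitz_like_of_integrably_locally_lipschitzian:
  fixes \<Phi> :: "'t \<Rightarrow> 'a::euclidean_space \<Rightarrow> 'b::euclidean_space set"
  assumes cpl: "complete_measure M" and fin: "finite_measure M" and norm: "normal_integrand M \<Phi>"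
    and y: "ybar \<in> expected_integral M \<Phi> xbar"
    and lip: "integrably_locally_lipschitzian M \<Phi> xbar"
  shows "lipschitz_like (expected_integral M \<Phi>) xbar ybar"
proof -
  obtain \<eta> l That where \<eta>: "\<eta> > 0" and That: "That \<in> sets M" "emeasure M (space M - That) = 0"
    and l: "integrable M l"
    and incl: "\<And>t x x'. t \<in> That \<Longrightarrow> x \<in> cball xbar \<eta> \<Longrightarrow> x' \<in> cball xbar \<eta> \<Longrightarrow>
          \<Phi> t x \<subseteq> \<Phi> t x' + (\<lambda>b. (l t * norm (x - x')) *\<^sub>R b) ` cball 0 1"
    using lip unfolding integrably_locally_lipschitzian_def by blast
  have ThatAE: "AE t in M. t \<in> That"
    using That by (intro AE_I[of _ _ "space M - That"]) auto
  let ?c = "\<integral>t. \<bar>l t\<bar> \<partial>M"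
  have "expected_integral M \<Phi> u \<inter> UNIV \<subseteq>
      expected_integral M \<Phi> v + (\<lambda>b. (?c * norm (u - v)) *\<^sub>R b) ` cball 0 1"
    if uv: "u \<in> ball xbar \<eta>" "v \<in> ball xbar \<eta>" for u v
  proof
    fix y assume "y \<in> expected_integral M \<Phi> u \<inter> UNIV"
    then obtain Y where Y: "integrable M Y" "AE t in M. Y t \<in> \<Phi> t u" "y = (\<integral>t. Y t \<partial>M)"
      by (auto simp: expected_integral_def aumann_integral_def)
    have near: "AE t in M. \<exists>w\<in>\<Phi> t v. norm (w - Y t) \<le> \<bar>l t\<bar> * norm (u - v)"
      using Y(2) ThatAE
    proof eventually_elim
      case (elim t)
      then have "Y t \<in> \<Phi> t v + (\<lambda>b. (l t * norm (u - v)) *\<^sub>R b) ` cball 0 1"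
        using incl[of t u v] uv by auto
      then obtain w b where wb: "w \<in> \<Phi> t v" "norm b \<le> 1" "Y t = w + (l t * norm (u - v)) *\<^sub>R b"
        by (auto simp: set_plus_def)
      have "norm (w - Y t) = \<bar>l t\<bar> * norm (u - v) * norm b" using wb(3) by (simp add: abs_mult)
      also have "\<dots> \<le> \<bar>l t\<bar> * norm (u - v)" using wb(2) by (intro mult_left_le) auto
      finally show ?case using wb(1) by blast
    qed
    obtain z where z: "z \<in> borel_measurable M" "AE t in M. z t \<in> \<Phi> t v"
        "AE t in M. norm (z t - Y t) \<le> \<bar>l t\<bar> * norm (u - v)"
      by (rule lipschitzian_selection[OF cpl fin norm Y(1) near])
    show "y \<in> expected_integral M \<Phi> v + (\<lambda>b. (?c * norm (u - v)) *\<^sub>R b) ` cball 0 1"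
      unfolding Y(3) using l by (intro expected_integral_near[where k = "\<lambda>t. \<bar>l t\<bar> * norm (u - v)" and v = v and \<Phi> = \<Phi>,
            OF Y(1) z(1,2) _ z(3)]) auto
  qed
  then show ?thesis
    unfolding lipschitz_like_def using y \<eta>
    by (intro conjI exI[of _ ?c] exI[of _ "ball xbar \<eta>"] exI[of _ UNIV]) (auto simp: graph_of_def)
qed

text \<open>
  The quasi-Lipschitz data \<open>\<eta>\<close> and \<open>l\<close> depend on the selection around which they hold, whereas
  Lipschitz-likeness asks for one constant. The argument is therefore by contradiction: violations
  with constants \<open>k\<close> in shrinking neighbourhoods come with selections which, by inner
  semicompactness, accumulate in \<open>L\<^sup>1\<close> at a selection \<open>f\<close> over \<open>(xbar, ybar)\<close>. The data that belong to
  this one \<open>f\<close> allow the selections to be transported, at a cost that is independent of \<open>k\<close>.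
\<close>

lemma lipschitz_like_of_integrably_quasi_lipschitzian:
  fixes \<Phi> :: "'t \<Rightarrow> 'a::euclidean_space \<Rightarrow> 'b::euclidean_space set"
  assumes cpl: "complete_measure M" and fin: "finite_measure M" and norm: "normal_integrand M \<Phi>"
    and y: "ybar \<in> expected_integral M \<Phi> xbar"
    and quasi: "\<And>f. f \<in> selections M \<Phi> xbar ybar \<Longrightarrow> integrably_quasi_lipschitzian M \<Phi> xbar f"
    and semi: "inner_semicompact M (\<lambda>(x, y). selections M \<Phi> x y) (xbar, ybar)"
  shows "lipschitz_like (expected_integral M \<Phi>) xbar ybar"
proof (rule ccontr)
  interpret finite_measure M by fact
  let ?E = "expected_integral M \<Phi>"
  assume neg: "\<not> lipschitz_like ?E xbar ybar"
  have "\<forall>k::nat. \<exists>u v y. u \<in> ball xbar (1 / real (Suc k)) \<and> v \<in> ball xbar (1 / real (Suc k)) \<and>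
      y \<in> ball ybar (1 / real (Suc k)) \<and> y \<in> ?E u \<and>
      y \<notin> ?E v + (\<lambda>b. (real k * norm (u - v)) *\<^sub>R b) ` cball 0 1"
  proof (rule allI, rule ccontr)
    fix k :: nat
    let ?\<delta> = "1 / real (Suc k)"
    assume *: "\<not> (\<exists>u v y. u \<in> ball xbar ?\<delta> \<and> v \<in> ball xbar ?\<delta> \<and> y \<in> ball ybar ?\<delta> \<and> y \<in> ?E u \<and>
      y \<notin> ?E v + (\<lambda>b. (real k * norm (u - v)) *\<^sub>R b) ` cball 0 1)"
    have "lipschitz_like ?E xbar ybar"
      unfolding lipschitz_like_def
    proof (intro conjI exI[of _ "real k"] exI[of _ "ball xbar ?\<delta>"] exI[of _ "ball ybar ?\<delta>"])
      show "\<forall>u\<in>ball xbar ?\<delta>. \<forall>v\<in>ball xbar ?\<delta>. ?E u \<inter> ball ybar ?\<delta> \<subseteq>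
          ?E v + (\<lambda>b. (real k * norm (u - v)) *\<^sub>R b) ` cball 0 1"
        using * by blast
    qed (use y in \<open>auto simp: graph_of_def\<close>)
    then show False using neg by blast
  qed
  then obtain u v y where uvy: "\<And>k. u k \<in> ball xbar (1 / real (Suc k))"
      "\<And>k. v k \<in> ball xbar (1 / real (Suc k))" "\<And>k. y k \<in> ball ybar (1 / real (Suc k))"
      "\<And>k. y k \<in> ?E (u k)"
      "\<And>k. y k \<notin> ?E (v k) + (\<lambda>b. (real k * norm (u k - v k)) *\<^sub>R b) ` cball 0 1"
    by metis
  have shrink: "s \<longlonglongrightarrow> a" if "\<And>k. s k \<in> ball a (1 / real (Suc k))"
    for s :: "nat \<Rightarrow> 'c::metric_space" and a
  proof (rule metric_tendsto_imp_tendsto[OF lim_1_over_n[THEN LIMSEQ_Suc]])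
    show "\<forall>\<^sub>F k in sequentially. dist (s k) a \<le> dist (1 / real (Suc k)) 0"
      using that by (intro always_eventually allI) (auto simp: dist_commute less_imp_le)
  qed
  have lim: "u \<longlonglongrightarrow> xbar" "v \<longlonglongrightarrow> xbar" "y \<longlonglongrightarrow> ybar"
    using uvy(1-3) by (intro shrink; simp)+
  have "(\<lambda>k. (u k, y k)) \<longlonglongrightarrow> (xbar, ybar)" by (intro tendsto_Pair lim)
  moreover have "\<forall>k. (\<lambda>(x, y). selections M \<Phi> x y) (u k, y k) \<noteq> {}"
  proof
    fix k
    obtain g where "integrable M g" "AE t in M. g t \<in> \<Phi> t (u k)" "y k = (\<integral>t. g t \<partial>M)"
      using uvy(4)[of k] by (auto simp: expected_integral_def aumann_integral_def)
    then have "g \<in> selections M \<Phi> (u k) (y k)" by (simp add: selections_def)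
    then show "(\<lambda>(x, y). selections M \<Phi> x y) (u k, y k) \<noteq> {}" by auto
  qed
  ultimately obtain Y r f where Y: "\<And>k. Y k \<in> selections M \<Phi> (u k) (y k)" and r: "strict_mono r"
    and f: "integrable M f" and L1: "(\<lambda>k. norm_L1 M (\<lambda>t. Y (r k) t - f t)) \<longlonglongrightarrow> 0"
    using semi[unfolded inner_semicompact_def, rule_format, of "\<lambda>k. (u k, y k)"] by auto
  have limr: "(\<lambda>k. u (r k)) \<longlonglongrightarrow> xbar" "(\<lambda>k. v (r k)) \<longlonglongrightarrow> xbar" "(\<lambda>k. y (r k)) \<longlonglongrightarrow> ybar"
    using lim[THEN LIMSEQ_subseq_LIMSEQ[OF _ r]] by (simp_all add: o_def)
  have "f \<in> selections M \<Phi> xbar ybar"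
    by (rule selections_closed_L1[OF norm Y limr(1,3) f L1])
  from quasi[OF this] obtain \<eta> l where \<eta>: "\<eta> > 0" and l: "integrable M l" "\<forall>t\<in>space M. 0 \<le> l t"
    and q: "\<forall>x\<in>Linfty M. \<forall>y. \<forall>ys\<in>Linfty M.
          (AE t in M. norm (x t - xbar) \<le> \<eta>) \<longrightarrow>
          integrable M y \<longrightarrow> norm_L1 M (\<lambda>t. y t - f t) \<le> \<eta> \<longrightarrow>
          (AE t in M. y t \<in> \<Phi> t (x t)) \<longrightarrow>
          (AE t in M. \<forall>xs\<in>coderivative (\<Phi> t) (x t) (y t) (ys t). norm xs \<le> l t * norm (ys t))"
    unfolding integrably_quasi_lipschitzian_def by blast
  define c where "c = (\<integral>t. l t + 2 \<partial>M)"
  have "(\<lambda>k. norm (v (r k) - xbar) + norm (u (r k) - v (r k))) \<longlonglongrightarrow> norm (xbar - xbar) + norm (xbar - xbar)"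
    by (intro tendsto_intros limr)
  then have e1: "\<forall>\<^sub>F k in sequentially. norm (v (r k) - xbar) + norm (u (r k) - v (r k)) < \<eta>"
    by (rule order_tendstoD) (use \<eta> in simp)
  have "(\<lambda>k. norm_L1 M (\<lambda>t. Y (r k) t - f t) + c * norm (u (r k) - v (r k))) \<longlonglongrightarrow>
      0 + c * norm (xbar - xbar)"
    by (intro tendsto_intros limr L1)
  then have e2: "\<forall>\<^sub>F k in sequentially.
      norm_L1 M (\<lambda>t. Y (r k) t - f t) + c * norm (u (r k) - v (r k)) < \<eta>"
    by (rule order_tendstoD) (use \<eta> in simp)
  \<comment> \<open>\<open>c\<close> is the Lipschitz constant that transport achieves; the violated constants eventually exceed it.\<close>
  have e3: "\<forall>\<^sub>F k in sequentially. c \<le> real k"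
    using filterlim_real_sequentially by (simp add: filterlim_at_top)
  from eventually_conj[OF e1 eventually_conj[OF e2 e3]] obtain k
    where k: "norm (v (r k) - xbar) + norm (u (r k) - v (r k)) < \<eta>"
      "norm_L1 M (\<lambda>t. Y (r k) t - f t) + c * norm (u (r k) - v (r k)) < \<eta>" "c \<le> real k"
    using eventually_happens'[OF sequentially_bot] by blast
  have Yk: "integrable M (Y (r k))" "AE t in M. Y (r k) t \<in> \<Phi> t (u (r k))"
      "(\<integral>t. Y (r k) t \<partial>M) = y (r k)"
    using Y[of "r k"] by (auto simp: selections_def)
  obtain z where z: "z \<in> borel_measurable M" "AE t in M. z t \<in> \<Phi> t (v (r k))"
      "AE t in M. norm (z t - Y (r k) t) \<le> (l t + 2) * norm (u (r k) - v (r k))"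
  proof (rule quasi_lipschitzian_selection[where xbar = xbar and \<eta> = \<eta>,
        OF cpl fin norm l(1) _ _ f Yk(1,2)])
    show "0 \<le> l t" if "t \<in> space M" for t using l(2) that by blast
    show "AE t in M. \<forall>xs\<in>coderivative (\<Phi> t) (x t) (y t) (ys t). norm xs \<le> l t * norm (ys t)"
      if "x \<in> Linfty M" "ys \<in> Linfty M" "AE t in M. norm (x t - xbar) \<le> \<eta>" "integrable M y"
        "norm_L1 M (\<lambda>t. y t - f t) \<le> \<eta>" "AE t in M. y t \<in> \<Phi> t (x t)" for x y ys
      using q[rule_format, OF that(1,2,3,4,5,6)] .
  qed (use k(1,2)[THEN less_imp_le] in \<open>auto simp: c_def\<close>)
  have "y (r k) \<in> ?E (v (r k)) + (\<lambda>b. (real (r k) * norm (u (r k) - v (r k))) *\<^sub>R b) ` cball 0 1"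
    unfolding Yk(3)[symmetric]
  proof (rule expected_integral_near[where k = "\<lambda>t. (l t + 2) * norm (u (r k) - v (r k))"
        and v = "v (r k)" and \<Phi> = \<Phi>, OF Yk(1) z(1,2) _ z(3)])
    show "integrable M (\<lambda>t. (l t + 2) * norm (u (r k) - v (r k)))" using l(1) by simp
    have "c \<le> real (r k)" using k(3) seq_suble[OF r, of k] by linarith
    then show "(\<integral>t. (l t + 2) * norm (u (r k) - v (r k)) \<partial>M) \<le> real (r k) * norm (u (r k) - v (r k))"
      by (simp add: c_def mult_right_mono)
  qed
  then show False using uvy(5) by blast
qed

theorem theorem3p4:
  fixes M :: "'t measure"
    and Tna :: "'t set"
    and \<Phi> :: "'t \<Rightarrow> real ^ 'n \<Rightarrow> (real ^ 'm) set"
    and xbar :: "real ^ 'n"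
    and ybar :: "real ^ 'm"
    and \<rho> :: real
    and \<kappa> :: "'t \<Rightarrow> real"
  assumes "complete_measure M"
    and "finite_measure M"
    and "is_nonatomic_part M Tna"
    and "normal_integrand M \<Phi>"
    and "ybar \<in> expected_integral M \<Phi> xbar"
    and "\<rho> > 0"
    and "integrable M \<kappa>"
    and "\<And>x t. x \<in> cball xbar \<rho> \<Longrightarrow> t \<in> Tna \<Longrightarrow> convex (\<Phi> t x)"
    and "\<And>x t. x \<in> cball xbar \<rho> \<Longrightarrow> t \<in> space M \<Longrightarrow> \<Phi> t x \<subseteq> (\<lambda>b. \<kappa> t *\<^sub>R b) ` cball 0 1"
    and "((\<forall>f \<in> selections M \<Phi> xbar ybar. integrably_quasi_lipschitzian M \<Phi> xbar f) \<and>
           inner_semicompact M (\<lambda>(x, y). selections M \<Phi> x y) (xbar, ybar)) \<or>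
         integrably_locally_lipschitzian M \<Phi> xbar"
  shows "lipschitz_like (expected_integral M \<Phi>) xbar ybar"
  using assms(10)
proof
  assume "(\<forall>f \<in> selections M \<Phi> xbar ybar. integrably_quasi_lipschitzian M \<Phi> xbar f) \<and>
    inner_semicompact M (\<lambda>(x, y). selections M \<Phi> x y) (xbar, ybar)"
  then show ?thesis
    by (intro lipschitz_like_of_integrably_quasi_lipschitzian assms(1,2,4,5)) blast+
next
  assume "integrably_locally_lipschitzian M \<Phi> xbar"
  then show ?thesis
    by (intro lipschitz_like_of_integrably_locally_lipschitzian assms(1,2,4,5))
qed

end
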